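(* Let $M$ be a complete CAT($k$) space and $X\subseteq M$ compact; if $k>0$, assume $X$ is contained in a metric ball of radius $r<\frac{\pi}{2\sqrt{k}}$. Assume that all barycenters of probability measures on $X$ are contained in a compact subset $Y\subseteq M$. Then $X$ has a unique circumcenter $y$. Furthermore, $D\geq S(R,\infty,k)$, where $D=\sup_{x_1,x_2\in X}d(x_1,x_2)$ is the diameter of $X$ and $R$ its circumradius. If, in addition, there exists a variance maximizer $\mu\in P(X)$ supported on $n+1$ points (for an integer $n\ge 1$), then $D\geq S(R,n,k)$.
   Context: For $\mu\in P(X)$, $Var(\mu)=\inf_{z\in M}\int_X d^2(x,z)\,d\mu(x)$; a barycenter of $\mu$ is a point attaining the infimum, and a variance maximizer is a maximizer of $Var$ over $P(X)$. The circumradius is $R=\inf_{z\in M}\sup_{x\in X}d(x,z)$ and a circumcenter is a point $y\in M$ with $X\subseteq\bar B(y,R)$. For $k<0$: $S(R,n,k)=\frac{2}{\sqrt{-k}}\sinh^{-1}\big(\sqrt{\tfrac{n+1}{2n}}\sinh(\sqrt{-k}R)\big)$; for $k=0$: $S(R,n,k)=2R\sqrt{\tfrac{n+1}{2n}}$; for $k>0$: $S(R,n,k)=\frac{2}{\sqrt{k}}\sin^{-1}\big(\sqrt{\tfrac{n+1}{2n}}\sin(\sqrt{k}R)\big)$. $S(R,\infty,k)=\lim_{n\to\infty}S(R,n,k)$, i.e. the same formulas with $\sqrt{\tfrac{n+1}{2n}}$ replaced by $\tfrac{1}{\sqrt2}$ (so $S(R,\infty,0)=\sqrt2 R$). *)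

theory Defs
  imports "HOL-Probability.Probability"
begin

text \<open>k = 0: the plane x3 = 0 with the Euclidean distance;
 k > 0: the unit sphere with the angular distance scaled by 1/sqrt k (curvature k);
 k < 0: the upper sheet of the hyperboloid x1^2+x2^2-x3^2 = -1 with
 distance (1/sqrt(-k)) arcosh(minus the Minkowski product) (curvature k).\<close>

definition model_space :: "real \<Rightarrow> (real^3) set" where
  "model_space k =
    (if k = 0 then {x. x$3 = 0}
     else if k > 0 then {x. norm x = 1}
     else {x. x$3 > 0 \<and> (x$1)^2 + (x$2)^2 - (x$3)^2 = -1})"

definition model_dist :: "real \<Rightarrow> real^3 \<Rightarrow> real^3 \<Rightarrow> real" where
  "model_dist k x y =
    (if k = 0 then dist x y
     else if k > 0 then arccos (inner x y) / sqrt k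
     else arcosh (x$3 * y$3 - x$1 * y$1 - x$2 * y$2) / sqrt (-k))"

definition below_Dk :: "real \<Rightarrow> real \<Rightarrow> bool" where
  "below_Dk k a \<longleftrightarrow> (k \<le> 0 \<or> a < pi / sqrt k)"

definition geodesic_seg :: "(real \<Rightarrow> 'a::metric_space) \<Rightarrow> 'a \<Rightarrow> 'a \<Rightarrow> bool" where
  "geodesic_seg \<gamma> p q \<longleftrightarrow> \<gamma> 0 = p \<and> \<gamma> (dist p q) = q \<and>
     (\<forall>s\<in>{0..dist p q}. \<forall>t\<in>{0..dist p q}. dist (\<gamma> s) (\<gamma> t) = \<bar>s - t\<bar>)"

text \<open>Pairs (x, comparison point of x) for points x on a side [p,q] (geodesic \<gamma>)
 whose comparison side in the model space is [P,Q].\<close>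
definition side_pairs :: "real \<Rightarrow> (real \<Rightarrow> 'a::metric_space) \<Rightarrow> 'a \<Rightarrow> 'a \<Rightarrow> real^3 \<Rightarrow> real^3
    \<Rightarrow> ('a \<times> (real^3)) set" where
  "side_pairs k \<gamma> p q P Q =
     {(\<gamma> s, X) | s X. s \<in> {0..dist p q} \<and> X \<in> model_space k \<and>
        model_dist k P X = s \<and> model_dist k X Q = dist p q - s}"

text \<open>CAT(k) (Bridson--Haefliger): D_k-geodesic, and every geodesic triangle of perimeter
 less than 2 D_k satisfies the CAT(k) inequality d(x,y) \<le> d(x',y') for all points x,y of
 the triangle and their comparison points x',y' in a comparison triangle in M_k^2.\<close>
definition CAT :: "real \<Rightarrow> 'a::metric_space itself \<Rightarrow> bool" where
  "CAT k _ \<longleftrightarrow>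
    (\<forall>p q::'a. below_Dk k (dist p q) \<longrightarrow> (\<exists>\<gamma>. geodesic_seg \<gamma> p q)) \<and>
    (\<forall>(p::'a) q r \<gamma>1 \<gamma>2 \<gamma>3 P Q R.
        geodesic_seg \<gamma>1 p q \<and> geodesic_seg \<gamma>2 q r \<and> geodesic_seg \<gamma>3 r p \<and>
        below_Dk k ((dist p q + dist q r + dist r p) / 2) \<and>
        P \<in> model_space k \<and> Q \<in> model_space k \<and> R \<in> model_space k \<and>
        model_dist k P Q = dist p q \<and> model_dist k Q R = dist q r \<and>
        model_dist k R P = dist r p \<longrightarrow>
        (let T = side_pairs k \<gamma>1 p q P Q \<union> side_pairs k \<gamma>2 q r Q R \<union> side_pairs k \<gamma>3 r p R P
         in \<forall>(x, X)\<in>T. \<forall>(y, Y)\<in>T. dist x y \<le> model_dist k X Y))"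

definition Prob_on :: "'a::metric_space set \<Rightarrow> 'a measure set" where
  "Prob_on X = {\<mu>. prob_space \<mu> \<and> sets \<mu> = sets borel \<and> emeasure \<mu> X = 1}"

definition Var :: "'a::metric_space measure \<Rightarrow> real" where
  "Var \<mu> = (INF z. \<integral>x. (dist x z)^2 \<partial>\<mu>)"

definition barycenter :: "'a::metric_space measure \<Rightarrow> 'a \<Rightarrow> bool" where
  "barycenter \<mu> z \<longleftrightarrow> (\<integral>x. (dist x z)^2 \<partial>\<mu>) = Var \<mu>"

definition variance_maximizer :: "'a::metric_space set \<Rightarrow> 'a measure \<Rightarrow> bool" where
  "variance_maximizer X \<mu> \<longleftrightarrow> \<mu> \<in> Prob_on X \<and> (\<forall>\<nu>\<in>Prob_on X. Var \<nu> \<le> Var \<mu>)"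

definition circumradius :: "'a::metric_space set \<Rightarrow> real" where
  "circumradius X = (INF z. SUP x\<in>X. dist x z)"

definition circumcenter :: "'a::metric_space set \<Rightarrow> 'a \<Rightarrow> bool" where
  "circumcenter X y \<longleftrightarrow> X \<subseteq> cball y (circumradius X)"

definition diam_set :: "'a::metric_space set \<Rightarrow> real" where
  "diam_set X = (SUP p\<in>X \<times> X. dist (fst p) (snd p))"

definition S_coef :: "real \<Rightarrow> real \<Rightarrow> real \<Rightarrow> real" where
  "S_coef c R k =
    (if k < 0 then 2 / sqrt (-k) * arsinh (c * sinh (sqrt (-k) * R))
     else if k = 0 then 2 * R * c
     else 2 / sqrt k * arcsin (c * sin (sqrt k * R)))"

definition S :: "real \<Rightarrow> nat \<Rightarrow> real \<Rightarrow> real" where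
  "S R n k = S_coef (sqrt ((real n + 1) / (2 * real n))) R k"

definition S_inf :: "real \<Rightarrow> real \<Rightarrow> real" where
  "S_inf R k = S_coef (1 / sqrt 2) R k"

end

(* The variance of a probability measure on X is at most R^2, as one sees by testing at the
   circumcenter y. Conversely, a walk that starts at y and always takes a small step towards a
   farthest point of X visits targets x_i whose weighted empirical measure has variance at least
   R^2 - e: the comparison inequality at each step bounds d(w, x_i) from below for every w, and the
   bounds telescope. So a variance maximizer mu has variance R^2, y minimizes its second moment,
   and mu lives on points at distance R from y. For an atom x0 of mu of mass q >= 1/(n+1), the
   first variation of the second moment when y moves towards x0 gives q + (1 - q) c <= 0, where c
   is the cosine of the model angle with sides R, R, D; hence c <= -1/n, which is D >= S(R,n,k).
   The same variation of the largest distance to X gives c <= 0, which is D >= S(R,infinity,k).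
   For k > 0 the walk compares cosines of distances, since d^2 need not be convex at radii close to
   pi / (2 sqrt k); the convexity of cos (sqrt u) then yields the bound on the variance. *)
theory Submission
  imports Defs
begin

text \<open>The walk is the subgradient method with constant step length for the distance to the
  farthest point of X. Its telescoped inequality holds against every competitor w and is read here
  as a lower bound for the second moment of the targets about w; this does the work of a minimax
  theorem. For k < 0 the squared distance is a concave function of \<open>md\<close>, the wrong
  direction for turning the telescoped bound into one on squares. Circumcenters and the walk are
  therefore treated at curvature max k 0, after the comparison at 0 has been deduced from that at k
  < 0. Only the two variations at the end use k itself, because they carry the sharp constants. For
  k > 0 farthest distances along the walk must stay below pi / (2 sqrt k), hence the start at y and
  the control of the drift away from y. Moreover w ranges over all of M, whereas the comparison
  covers only perimeters below 2 pi / sqrt k. If w is farther than 2R from y, every point of X is at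
  distance at least R from w and the bound is immediate; otherwise an oversized triangle is replaced
  by a degenerate one on a great circle.\<close>

section \<open>Trigonometry of the model spaces\<close>

text \<open>\<open>sn k\<close> and \<open>cs k\<close> are the solutions of f'' = - k f with
  initial data (0, 1) and (1, 0), so that most identities below hold for all signs of k at
  once.\<close>

definition sn :: "real \<Rightarrow> real \<Rightarrow> real" where
  "sn k t = (if k = 0 then t else if k > 0 then sin (sqrt k * t) / sqrt k
     else sinh (sqrt (-k) * t) / sqrt (-k))"

definition cs :: "real \<Rightarrow> real \<Rightarrow> real" where
  "cs k t = (if k = 0 then 1 else if k > 0 then cos (sqrt k * t) else cosh (sqrt (-k) * t))"

text \<open>\<open>md k t = (1 - cs k t) / k\<close>, in a form that also covers \<open>k = 0\<close>.\<close>
definition md :: "real \<Rightarrow> real \<Rightarrow> real" where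
  "md k t = 2 * (sn k (t / 2))\<^sup>2"

lemma sn_0 [simp]: "sn k 0 = 0"
  by (simp add: sn_def)

lemma cs_0 [simp]: "cs k 0 = 1"
  by (simp add: cs_def)

lemma md_0 [simp]: "md k 0 = 0"
  by (simp add: md_def)

lemma sn_minus: "sn k (- t) = - sn k t"
  by (simp add: sn_def)

lemma cs_minus: "cs k (- t) = cs k t"
  by (simp add: cs_def)

lemma cs_sn_pythag: "(cs k t)\<^sup>2 + k * (sn k t)\<^sup>2 = 1"
  using cosh_square_eq[of "sqrt (-k) * t"]
  by (auto simp: sn_def cs_def power_divide)

lemma sn_add: "sn k (x + y) = sn k x * cs k y + cs k x * sn k y"
  by (simp add: sn_def cs_def sin_add sinh_add distrib_left add_divide_distrib)

lemma cs_add: "cs k (x + y) = cs k x * cs k y - k * sn k x * sn k y"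
  by (auto simp: sn_def cs_def cos_add cosh_add distrib_left)

lemma sn_diff: "sn k (x - y) = sn k x * cs k y - cs k x * sn k y"
  using sn_add[of k x "-y"] by (simp add: sn_minus cs_minus)

lemma cs_diff: "cs k (x - y) = cs k x * cs k y + k * sn k x * sn k y"
  using cs_add[of k x "-y"] by (simp add: sn_minus cs_minus)

lemma md_cs: "k * md k t = 1 - cs k t"
  using cs_add[of k "t/2" "t/2"] cs_sn_pythag[of k "t/2"]
  by (simp add: md_def power2_eq_square algebra_simps)

text \<open>This is (1 - cs)(1 + cs) = k sn^2 with the factor k cancelled; half angles make it valid
  for k = 0 as well.\<close>

lemma sn_md: "(sn k t)\<^sup>2 = md k t * (1 + cs k t)"
proof -
  have 1: "sn k t = 2 * sn k (t/2) * cs k (t/2)" using sn_add[of k "t/2" "t/2"] by simp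
  have 2: "1 + cs k t = 2 * (cs k (t/2))\<^sup>2"
    using cs_add[of k "t/2" "t/2"] cs_sn_pythag[of k "t/2"] by (simp add: power2_eq_square algebra_simps)
  show ?thesis unfolding 1 2 md_def by (simp add: power_mult_distrib)
qed

lemma md_nonneg [simp]: "0 \<le> md k t"
  by (simp add: md_def)

lemma has_derivative_sn [derivative_intros]:
  "((sn k) has_real_derivative cs k t) (at t within A)"
proof -
  have "(sn k) = (\<lambda>t. if k = 0 then t else if k > 0 then sin (sqrt k * t) / sqrt k
     else sinh (sqrt (-k) * t) / sqrt (-k))" by (auto simp: sn_def)
  moreover have "((\<lambda>t. if k = 0 then t else if k > 0 then sin (sqrt k * t) / sqrt k
     else sinh (sqrt (-k) * t) / sqrt (-k)) has_real_derivative cs k t) (at t within A)"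
    by (cases "k = 0"; cases "k > 0") (auto simp: cs_def mult.assoc intro!: derivative_eq_intros)
  ultimately show ?thesis by simp
qed

lemma sn_half_cs: "sn k t = 2 * sn k (t/2) * cs k (t/2)"
  using sn_add[of k "t/2" "t/2"] by simp

lemma has_derivative_md: "((md k) has_real_derivative sn k t) (at t within A)"
proof -
  have "((\<lambda>t. 2 * (sn k (t / 2))\<^sup>2) has_real_derivative sn k t) (at t within A)"
    by (auto intro!: derivative_eq_intros DERIV_chain2[OF has_derivative_sn]
        simp: sn_half_cs[of k t])
  then show ?thesis unfolding md_def .
qed

lemma isCont_md: "isCont (md k) t"
  using has_derivative_md DERIV_isCont by blast

lemma sn_pos: "0 < t \<Longrightarrow> below_Dk k t \<Longrightarrow> 0 < sn k t"
  by (auto simp: sn_def below_Dk_def field_simps intro!: divide_pos_pos sin_gt_zero)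

lemma sn_nonneg: "0 \<le> t \<Longrightarrow> (0 < k \<Longrightarrow> t \<le> pi / sqrt k) \<Longrightarrow> 0 \<le> sn k t"
  by (auto simp: sn_def field_simps intro!: divide_nonneg_pos sin_ge_zero)

lemma cs_pos: "0 \<le> t \<Longrightarrow> below_Dk k (2 * t) \<Longrightarrow> 0 < cs k t"
  by (auto simp: cs_def below_Dk_def field_simps intro!: cos_gt_zero_pi intro: less_le_trans[of _ 0])

lemma below_Dk_mono: "below_Dk k b \<Longrightarrow> a \<le> b \<Longrightarrow> below_Dk k a"
  by (auto simp: below_Dk_def)

lemma md_mono:
  assumes "0 \<le> a" "a \<le> b" "0 < k \<Longrightarrow> b \<le> pi / sqrt k" shows "md k a \<le> md k b"
proof (rule DERIV_nonneg_imp_nondecreasing[OF assms(2)])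
  fix x assume "a \<le> x" "x \<le> b"
  then show "\<exists>y. DERIV (md k) x :> y \<and> 0 \<le> y"
    using has_derivative_md sn_nonneg[of x k] assms by fastforce
qed

lemma md_strict_mono:
  assumes "0 \<le> a" "a < b" "0 < k \<Longrightarrow> b \<le> pi / sqrt k" shows "md k a < md k b"
proof (rule DERIV_pos_imp_increasing_open[OF assms(2)])
  fix x assume "a < x" "x < b"
  then show "\<exists>y. DERIV (md k) x :> y \<and> 0 < y"
    using has_derivative_md sn_pos[of x k] assms by (fastforce simp: below_Dk_def)
next
  show "continuous_on {a..b} (md k)" using isCont_md continuous_at_imp_continuous_on by blast
qed

text \<open>For k > 0, \<open>sn\<close> increases only up to pi / (2 sqrt k), half the range of
  \<open>md\<close>; hence the bound on \<open>2 * b\<close>.\<close>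

lemma sn_strict_mono:
  assumes "0 \<le> a" "a < b" "below_Dk k (2 * b)" shows "sn k a < sn k b"
proof (rule DERIV_pos_imp_increasing[OF assms(2)])
  fix x assume "a \<le> x" "x \<le> b"
  then show "\<exists>y. DERIV (sn k) x :> y \<and> 0 < y"
    using has_derivative_sn cs_pos[of x k] assms below_Dk_mono[of k "2*b" "2*x"] by fastforce
qed

lemma sn_mono:
  assumes "0 \<le> a" "a \<le> b" "below_Dk k (2 * b)" shows "sn k a \<le> sn k b"
  using sn_strict_mono[OF assms(1) _ assms(3)] assms(2) by (cases "a = b") auto

lemma sn_le_self: "0 \<le> k \<Longrightarrow> 0 \<le> t \<Longrightarrow> sn k t \<le> t"
  using sin_x_le_x[of "sqrt k * t"] by (auto simp: sn_def field_simps)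

text \<open>The equality case of the comparison: the third point lies on the line through q and p,
  at distance a beyond p, so its distances to z and q are a + s and L + a. As an identity for all
  reals it remains available when L + a exceeds pi / sqrt k.\<close>

lemma stewart_collinear:
  "sn k L * md k (a + s) = sn k (L - s) * (md k a - md k s) + sn k s * (md k (L + a) - md k (L - s))"
proof (cases "k = 0")
  case True then show ?thesis by (simp add: sn_def md_def power2_eq_square field_simps)
next
  case False
  have P: "k * sn k s * sn k s = 1 - cs k s * cs k s" "k * sn k L * sn k L = 1 - cs k L * cs k L"
    "k * sn k a * sn k a = 1 - cs k a * cs k a"
    using cs_sn_pythag[of k s] cs_sn_pythag[of k L] cs_sn_pythag[of k a]by (auto simp: power2_eq_square)
  have "k * (sn k L * md k (a + s)) = sn k L * (1 - cs k (a+s))" by (simp add: mult.left_commute[of k] md_cs)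
  also have "\<dots> = sn k (L - s) * (cs k s - cs k a) + sn k s * (cs k (L-s) - cs k (L+a))"
    unfolding sn_diff cs_add cs_diff using P by algebra
  also have "\<dots> = sn k (L - s) * (k * md k a - k * md k s) + sn k s * (k * md k (L + a) - k * md k (L - s))"
    unfolding md_cs by simp
  finally have "k * (sn k L * md k (a + s)) = k * (sn k (L - s) * (md k a - md k s) + sn k s * (md k (L + a) - md k (L - s)))"
    by (simp add: algebra_simps)
  with False show ?thesis by simp
qed

section \<open>Comparison inequality\<close>

text \<open>The law of cosines in the model space eliminates the angle between \<open>[p,z]\<close> and \<open>[p,r]\<close> from
  the comparison triangle of \<open>p, q, r\<close>; with \<open>md\<close> in place of \<open>cs\<close>, the sign of \<open>k\<close> drops out.\<close>
definition stewart :: "real \<Rightarrow> 'a::metric_space itself \<Rightarrow> bool" where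
  "stewart k _ \<longleftrightarrow> (\<forall>(p::'a) q s. below_Dk k (dist p q) \<longrightarrow> 0 \<le> s \<longrightarrow> s \<le> dist p q \<longrightarrow>
     (\<exists>z. dist p z = s \<and> dist z q = dist p q - s \<and>
       (\<forall>r. below_Dk k ((dist p q + dist q r + dist r p) / 2) \<longrightarrow>
          sn k (dist p q) * md k (dist r z)
            \<le> sn k (dist p q - s) * (md k (dist r p) - md k s)
              + sn k s * (md k (dist r q) - md k (dist p q - s)))))"


section \<open>Comparison triangles in coordinates\<close>

lemma model_dist_refl: "X \<in> model_space k \<Longrightarrow> model_dist k X X = 0"
  by (auto simp: model_space_def model_dist_def power2_eq_square norm_eq_1 split: if_splits)

text \<open>P is the pole, Q and X lie on one meridian, and R has polar distance
  \<open>u * a\<close> and azimuth of cosine \<open>c\<close>, determined by the law of cosines. The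
  identity holds because sin l X = sin (l - t) P + sin t Q and the cosine of the distance to R is
  linear in X.\<close>

lemma model_triangle_pos:
  fixes a b L s :: real
  assumes k: "0 < k" and "0 \<le> a" "0 \<le> b" "0 < L" "a \<le> b + L" "b \<le> a + L" "L \<le> a + b" "0 \<le> s" "s \<le> L"
    and per: "below_Dk k ((L + b + a) / 2)"
  shows "\<exists>P Q R X. {P, Q, R, X} \<subseteq> model_space k \<and> model_dist k P Q = L \<and> model_dist k Q R = b \<and>
    model_dist k R P = a \<and> model_dist k P X = s \<and> model_dist k X Q = L - s \<and>
    sn k L * md k (model_dist k X R) = sn k (L - s) * (md k a - md k s) + sn k s * (md k b - md k (L - s))"
proof -
  define u where "u = sqrt k"
  have u: "0 < u" "u * u = k" using k by (auto simp: u_def)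
  have ua: "0 \<le> u * a" "u * a \<le> pi" and ub: "0 \<le> u * b" "u * b \<le> pi" and uL: "0 < u * L" "u * L < pi"
    and us: "0 \<le> u * s" "u * s \<le> u * L"
    and per': "u * L + u * b + u * a < 2 * pi" "u * a \<le> u * b + u * L" "u * b \<le> u * a + u * L" "u * L \<le> u * a + u * b"
  proof -
    have "L + b + a < 2 * pi / u" using per k u unfolding below_Dk_def u_def by (simp add: mult.commute)
    then have *: "u * (L + b + a) < 2 * pi" using u by (simp add: field_simps)
    have t: "u * a \<le> u * (b + L)" "u * b \<le> u * (a + L)" "u * L \<le> u * (a + b)" "u * s \<le> u * L"
      using assms u by (intro mult_left_mono; simp)+
    show "u * L + u * b + u * a < 2 * pi" "u * a \<le> u * b + u * L" "u * b \<le> u * a + u * L" "u * L \<le> u * a + u * b"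
      "u * s \<le> u * L"
      using * t by (simp_all add: algebra_simps)
    then show "u * a \<le> pi" "u * b \<le> pi" "u * L < pi" using * t by (simp_all add: algebra_simps)
    show "0 \<le> u * a" "0 \<le> u * b" "0 < u * L" "0 \<le> u * s" using assms u by simp_all
  qed
  define A B l t where "A = u * a" and "B = u * b" and "l = u * L" and "t = u * s"
  note * = ua ub uL us per'
  note D = *[folded A_def B_def l_def t_def]
  have sl: "0 < sin l" using D by (intro sin_gt_zero) auto
  have sA: "0 \<le> sin A" using D by (intro sin_ge_zero) auto
  obtain c where c: "\<bar>c\<bar> \<le> 1" "cos B = cos A * cos l + sin A * sin l * c"
  proof (cases "sin A = 0")
    case True
    then have "A = 0 \<or> A = pi" using D by (metis antisym_conv1 less_irrefl sin_gt_zero)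
    \<comment> \<open>A = pi would force B + l >= pi by the triangle inequality, but B + l < pi by
      the perimeter.\<close>
    then have "A = 0" using D by auto
    then have "B = l" using D by simp
    then show ?thesis using that[of 0] \<open>A = 0\<close> by simp
  next
    case False
    then have p: "0 < sin A * sin l" using sA sl by simp
    have 1: "cos B \<le> cos (A - l)"
      using cos_mono_le_eq[of B "\<bar>A - l\<bar>"] D by auto
    have 2: "cos (A + l) \<le> cos B"
    proof (cases "A + l \<le> pi")
      case True then show ?thesis using cos_mono_le_eq[of "A + l" B] D by auto
    next
      case False
      \<comment> \<open>Cosine decreases only up to pi, so A + l is reflected; the perimeter bound
        says that the reflected angle is still at least B.\<close>
      have "cos (2 * pi - (A + l)) \<le> cos B"
        using cos_mono_le_eq[of "2 * pi - (A + l)" B] D False by auto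
      then show ?thesis by (simp add: cos_diff)
    qed
    define c where "c = (cos B - cos A * cos l) / (sin A * sin l)"
    have "c \<le> 1" "-1 \<le> c" using 1 2 p unfolding c_def cos_add cos_diff
      by (simp_all add: pos_divide_le_eq pos_le_divide_eq)
    moreover have "cos B = cos A * cos l + sin A * sin l * c" using False sl unfolding c_def by simp
    ultimately show ?thesis by (intro that[of c]) auto
  qed
  define e where "e = sqrt (1 - c\<^sup>2)"
  have e: "c\<^sup>2 + e\<^sup>2 = 1" unfolding e_def using c abs_le_square_iff[of c 1] by simp
  define P Q R X :: "real^3" where "P = vector [0, 0, 1]" and "Q = vector [sin l, 0, cos l]"
    and "R = vector [sin A * c, sin A * e, cos A]" and "X = vector [sin t, 0, cos t]"
  note Ds = P_def Q_def R_def X_def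
  have nR: "sin A * c * (sin A * c) + sin A * e * (sin A * e) + cos A * cos A = 1"
    using e sin_cos_squared_add[of A] by algebra
  have mem: "{P, Q, R, X} \<subseteq> model_space k"
    using k nR by (simp add: Ds model_space_def norm_eq_1 inner_vec_def sum_3 flip: power2_eq_square)
  have md: "model_dist k Y Z = arccos (Y$1 * Z$1 + Y$2 * Z$2 + Y$3 * Z$3) / u" for Y Z
    using k by (simp add: model_dist_def u_def inner_vec_def sum_3)
  have XR: "cos (u * model_dist k X R) = sin t * sin A * c + cos t * cos A"
  proof -
    have "\<bar>inner X R\<bar> \<le> 1" using mem k Cauchy_Schwarz_ineq2[of X R] by (simp add: model_space_def)
    moreover have "inner X R = sin t * sin A * c + cos t * cos A" by (simp add: Ds inner_vec_def sum_3)
    ultimately show ?thesis using u(1) k by (simp add: model_dist_def flip: u_def)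
  qed
  have "sin l * cos (u * model_dist k X R) = sin (l - t) * cos A + sin t * cos B"
    unfolding XR c(2) sin_diff by (simp add: algebra_simps)
  moreover have "sin l = sin (l - t) * cos t + sin t * cos (l - t)"
    using sin_add[of "l - t" t] by (simp add: algebra_simps)
  ultimately have "sin l * (1 - cos (u * model_dist k X R))
      = sin (l - t) * (cos t - cos A) + sin t * (cos (l - t) - cos B)"
    by (simp add: right_diff_distrib)
  then have "sin l / u * (1 - cos (u * model_dist k X R))
      = sin (l - t) / u * (cos t - cos A) + sin t / u * (cos (l - t) - cos B)"
    by (simp flip: add_divide_distrib)
  moreover have "sn k x = sin (u * x) / u" "cs k x = cos (u * x)" for x using k by (auto simp: sn_def cs_def u_def)
  ultimately have "sn k L * (1 - cs k (model_dist k X R))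
      = sn k (L - s) * (cs k s - cs k a) + sn k s * (cs k (L - s) - cs k b)"
    by (simp add: A_def B_def l_def t_def right_diff_distrib)
  then have "sn k L * (k * md k (model_dist k X R))
      = sn k (L - s) * (k * md k a - k * md k s) + sn k s * (k * md k b - k * md k (L - s))"
    unfolding md_cs by simp
  then have "k * (sn k L * md k (model_dist k X R))
      = k * (sn k (L - s) * (md k a - md k s) + sn k s * (md k b - md k (L - s)))"
    by (simp add: algebra_simps)
  then have F: "sn k L * md k (model_dist k X R) = sn k (L - s) * (md k a - md k s) + sn k s * (md k b - md k (L - s))"
    using k by simp
  have "arccos (cos l) = l" "arccos (cos t) = t" "arccos (cos A) = A"
    by (rule arccos_cos; use D in simp)+
  then have "model_dist k P Q = L" "model_dist k P X = s" "model_dist k R P = a"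
    unfolding md using u(1) by (simp_all add: Ds) (simp_all add: A_def l_def t_def)
  moreover have "model_dist k Q R = b"
  proof -
    have "Q$1 * R$1 + Q$2 * R$2 + Q$3 * R$3 = cos B" using c(2) by (simp add: Ds algebra_simps)
    then show ?thesis using md D u by (simp add: arccos_cos) (simp add: B_def)
  qed
  moreover have "model_dist k X Q = L - s"
  proof -
    have "X$1 * Q$1 + X$2 * Q$2 + X$3 * Q$3 = cos (l - t)" by (simp add: Ds cos_diff)
    moreover have "arccos (cos (l - t)) = l - t" using D by (intro arccos_cos) auto
    ultimately have "model_dist k X Q = (l - t) / u" using md by simp
    then show ?thesis using u(1) by (simp add: l_def t_def flip: right_diff_distrib)
  qed
  ultimately show ?thesis using mem F by blast
qed

lemma model_triangle_zero:
  fixes a b L s :: real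
  assumes "0 \<le> a" "0 \<le> b" "0 < L" "a \<le> b + L" "b \<le> a + L" "L \<le> a + b" "0 \<le> s" "s \<le> L"
  shows "\<exists>P Q R X. {P, Q, R, X} \<subseteq> model_space 0 \<and> model_dist 0 P Q = L \<and> model_dist 0 Q R = b \<and>
    model_dist 0 R P = a \<and> model_dist 0 P X = s \<and> model_dist 0 X Q = L - s \<and>
    sn 0 L * md 0 (model_dist 0 X R) = sn 0 (L - s) * (md 0 a - md 0 s) + sn 0 s * (md 0 b - md 0 (L - s))"
proof -
  \<comment> \<open>Unlike in the spherical case \<open>c\<close> is a length: the abscissa of R,
    that is, a times the cosine of the angle at P.\<close>
  define c where "c = (a\<^sup>2 + L\<^sup>2 - b\<^sup>2) / (2 * L)"
  have Lc: "2 * L * c = a\<^sup>2 + L\<^sup>2 - b\<^sup>2" using assms by (simp add: c_def)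
  have "c \<le> a"
  proof -
    have "(a - L)\<^sup>2 \<le> b\<^sup>2" using assms by (intro abs_le_square_iff[THEN iffD1]) auto
    then have "2 * L * c \<le> 2 * L * a" unfolding Lc by (simp add: power2_eq_square algebra_simps)
    then show ?thesis using assms by simp
  qed
  moreover have "- a \<le> c"
  proof -
    have "b\<^sup>2 \<le> (a + L)\<^sup>2" using assms by (intro abs_le_square_iff[THEN iffD1]) auto
    then have "L * (- a) \<le> L * c" using Lc by (simp add: power2_eq_square algebra_simps)
    then show ?thesis using mult_le_cancel_left_pos[OF \<open>0 < L\<close>] by blast
  qed
  ultimately have "c\<^sup>2 \<le> a\<^sup>2" by (intro abs_le_square_iff[THEN iffD1]) auto
  define e where "e = sqrt (a\<^sup>2 - c\<^sup>2)"
  have e: "c\<^sup>2 + e\<^sup>2 = a\<^sup>2" unfolding e_def using \<open>c\<^sup>2 \<le> a\<^sup>2\<close> by simp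
  define P Q R X :: "real^3" where "P = vector [0, 0, 0]" and "Q = vector [L, 0, 0]"
    and "R = vector [c, e, 0]" and "X = vector [s, 0, 0]"
  note Ds = P_def Q_def R_def X_def
  have mem: "{P, Q, R, X} \<subseteq> model_space 0"
    by (simp add: Ds model_space_def)
  have md: "model_dist 0 Y Z = sqrt ((Y$1 - Z$1)\<^sup>2 + (Y$2 - Z$2)\<^sup>2 + (Y$3 - Z$3)\<^sup>2)" for Y Z
    by (simp add: model_dist_def dist_vec_def L2_set_def sum_3 dist_real_def)
  have "2 * L * (model_dist 0 X R)\<^sup>2 = 2 * L * ((s - c)\<^sup>2 + e\<^sup>2)"
    unfolding md by (simp add: Ds)
  also have "\<dots> = 2 * ((L - s) * (a\<^sup>2 - s\<^sup>2) + s * (b\<^sup>2 - (L - s)\<^sup>2))"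
    using Lc e by algebra
  finally have F: "sn 0 L * md 0 (model_dist 0 X R) = sn 0 (L - s) * (md 0 a - md 0 s) + sn 0 s * (md 0 b - md 0 (L - s))"
    by (simp add: sn_def md_def power2_eq_square field_simps)
  have "(L - c)\<^sup>2 + e\<^sup>2 = b\<^sup>2" using Lc e by algebra
  then have "model_dist 0 Q R = b" "model_dist 0 P Q = L" "model_dist 0 P X = s" "model_dist 0 R P = a" "model_dist 0 X Q = L - s"
    unfolding md using assms e by (simp_all add: Ds)
  then show ?thesis using mem F by blast
qed

lemma model_triangle_neg:
  fixes a b L s :: real
  assumes k: "k < 0" and "0 \<le> a" "0 \<le> b" "0 < L" "a \<le> b + L" "b \<le> a + L" "L \<le> a + b" "0 \<le> s" "s \<le> L"
  shows "\<exists>P Q R X. {P, Q, R, X} \<subseteq> model_space k \<and> model_dist k P Q = L \<and> model_dist k Q R = b \<and>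
    model_dist k R P = a \<and> model_dist k P X = s \<and> model_dist k X Q = L - s \<and>
    sn k L * md k (model_dist k X R) = sn k (L - s) * (md k a - md k s) + sn k s * (md k b - md k (L - s))"
proof -
  define u where "u = sqrt (-k)"
  have u: "0 < u" "u * u = -k" using k by (auto simp: u_def)
  have *: "0 \<le> u * a" "0 \<le> u * b" "0 < u * L" "0 \<le> u * s" "u * s \<le> u * L"
    "u * a \<le> u * b + u * L" "u * b \<le> u * a + u * L" "u * L \<le> u * a + u * b"
    using assms u by (auto simp flip: distrib_left)
  define A B l t where "A = u * a" and "B = u * b" and "l = u * L" and "t = u * s"
  note D = *[folded A_def B_def l_def t_def]
  have sl: "0 < sinh l" using D by simp
  have sA: "0 \<le> sinh A" using D by simp
  obtain c where c: "\<bar>c\<bar> \<le> 1" "cosh B = cosh A * cosh l - sinh A * sinh l * c"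
  proof (cases "sinh A = 0")
    case True
    then have "A = 0" by simp
    then have "B = l" using D by simp
    then show ?thesis using that[of 0] \<open>A = 0\<close> by simp
  next
    case False
    then have p: "0 < sinh A * sinh l" using sA sl by (metis less_eq_real_def mult_pos_pos)
    have 1: "cosh (A - l) \<le> cosh B"
      using cosh_real_nonneg_le_iff[of "\<bar>A - l\<bar>" B] D by (auto simp: cosh_real_abs)
    have 2: "cosh B \<le> cosh (A + l)" using cosh_real_nonneg_le_iff[of B "A + l"] D by auto
    define c where "c = (cosh A * cosh l - cosh B) / (sinh A * sinh l)"
    have "c \<le> 1" "-1 \<le> c" using 1 2 p unfolding c_def cosh_add cosh_diff
      by (simp_all add: pos_divide_le_eq pos_le_divide_eq)
    moreover have "cosh B = cosh A * cosh l - sinh A * sinh l * c" using False sl unfolding c_def by simp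
    ultimately show ?thesis by (intro that[of c]) auto
  qed
  define e where "e = sqrt (1 - c\<^sup>2)"
  have e: "c\<^sup>2 + e\<^sup>2 = 1" unfolding e_def using c abs_le_square_iff[of c 1] by simp
  define P Q R X :: "real^3" where "P = vector [0, 0, 1]" and "Q = vector [sinh l, 0, cosh l]"
    and "R = vector [sinh A * c, sinh A * e, cosh A]" and "X = vector [sinh t, 0, cosh t]"
  note Ds = P_def Q_def R_def X_def
  have nR: "(sinh A * c)\<^sup>2 + (sinh A * e)\<^sup>2 - (cosh A)\<^sup>2 = -1"
    using e cosh_square_eq[of A] by algebra
  have mem: "{P, Q, R, X} \<subseteq> model_space k"
    using k nR by (simp add: Ds model_space_def cosh_square_eq)
  have md: "model_dist k Y Z = arcosh (Y$3 * Z$3 - Y$1 * Z$1 - Y$2 * Z$2) / u" for Y Z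
    using k by (simp add: model_dist_def u_def)
  have XR: "cosh (u * model_dist k X R) = cosh t * cosh A - sinh t * sinh A * c"
  proof -
    \<comment> \<open>\<open>arcosh\<close> inverts \<open>cosh\<close> only from 1 on. The
      Minkowski product is smallest at azimuth cosine 1, where it equals cosh (t - A).\<close>
    have "1 \<le> cosh (t - A)" by (rule cosh_real_ge_1)
    also have "\<dots> \<le> cosh t * cosh A - sinh t * sinh A * c"
      using mult_left_mono[of c 1 "sinh t * sinh A"] c(1) sA D unfolding cosh_diff by simp
    finally show ?thesis using u(1) by (simp add: md Ds mult.assoc)
  qed
  have "sinh l * cosh (u * model_dist k X R) = sinh (l - t) * cosh A + sinh t * cosh B"
    unfolding XR c(2) sinh_diff by (simp add: algebra_simps)
  moreover have "sinh l = sinh (l - t) * cosh t + sinh t * cosh (l - t)"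
    using sinh_add[of "l - t" t] by (simp add: algebra_simps)
  ultimately have "sinh l * (1 - cosh (u * model_dist k X R))
      = sinh (l - t) * (cosh t - cosh A) + sinh t * (cosh (l - t) - cosh B)"
    by (simp add: right_diff_distrib)
  then have "sinh l / u * (1 - cosh (u * model_dist k X R))
      = sinh (l - t) / u * (cosh t - cosh A) + sinh t / u * (cosh (l - t) - cosh B)"
    by (simp flip: add_divide_distrib)
  moreover have "sn k x = sinh (u * x) / u" "cs k x = cosh (u * x)" for x using k by (auto simp: sn_def cs_def u_def)
  ultimately have "sn k L * (1 - cs k (model_dist k X R))
      = sn k (L - s) * (cs k s - cs k a) + sn k s * (cs k (L - s) - cs k b)"
    by (simp add: A_def B_def l_def t_def right_diff_distrib)
  then have "sn k L * (k * md k (model_dist k X R))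
      = sn k (L - s) * (k * md k a - k * md k s) + sn k s * (k * md k b - k * md k (L - s))"
    unfolding md_cs by simp
  then have "k * (sn k L * md k (model_dist k X R))
      = k * (sn k (L - s) * (md k a - md k s) + sn k s * (md k b - md k (L - s)))"
    by (simp add: algebra_simps)
  then have F: "sn k L * md k (model_dist k X R) = sn k (L - s) * (md k a - md k s) + sn k s * (md k b - md k (L - s))"
    using k by simp
  have "arcosh (cosh l) = l" "arcosh (cosh t) = t" "arcosh (cosh A) = A"
    by (rule arcosh_cosh_real; use D in simp)+
  then have "model_dist k P Q = L" "model_dist k P X = s" "model_dist k R P = a"
    unfolding md using u(1) by (simp_all add: Ds) (simp_all add: A_def l_def t_def)
  moreover have "model_dist k Q R = b"
  proof -
    have "Q$3 * R$3 - Q$1 * R$1 - Q$2 * R$2 = cosh B" using c(2) by (simp add: Ds algebra_simps)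
    then show ?thesis using md D u by (simp add: arcosh_cosh_real) (simp add: B_def)
  qed
  moreover have "model_dist k X Q = L - s"
  proof -
    have "X$3 * Q$3 - X$1 * Q$1 - X$2 * Q$2 = cosh (l - t)" by (simp add: Ds cosh_diff)
    moreover have "arcosh (cosh (l - t)) = l - t" using D by (intro arcosh_cosh_real) auto
    ultimately have "model_dist k X Q = (l - t) / u" using md by simp
    then show ?thesis using u(1) by (simp add: l_def t_def flip: right_diff_distrib)
  qed
  ultimately show ?thesis using mem F by blast
qed

text \<open>The point z is taken on one fixed geodesic from p to q and hence serves all r at once;
  the variations below move one center and compare it with all points of X simultaneously.\<close>

lemma CAT_imp_stewart:
  assumes "CAT k TYPE('a::metric_space)"
  shows "stewart k TYPE('a)"
  unfolding stewart_def
proof (intro allI impI)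
  fix p q :: 'a and s
  assume Dk: "below_Dk k (dist p q)" and s: "0 \<le> s" "s \<le> dist p q"
  have geo: "\<exists>\<gamma>. geodesic_seg \<gamma> x y" if "below_Dk k (dist x y)" for x y :: 'a
    using assms that by (simp add: CAT_def)
  obtain g where g: "geodesic_seg g p q" using geo[OF Dk] by blast
  define z where "z = g s"
  have "dist (g s) (g t) = \<bar>s - t\<bar>" if "t \<in> {0..dist p q}" for t
    using g s that unfolding geodesic_seg_def by auto
  from this[of 0] this[of "dist p q"] have "dist (g 0) (g s) = s" "dist (g s) (g (dist p q)) = dist p q - s"
    using s by (auto simp: dist_commute)
  then have pz: "dist p z = s" "dist z q = dist p q - s" using g unfolding geodesic_seg_def z_def by auto
  moreover have "sn k (dist p q) * md k (dist r z)
            \<le> sn k (dist p q - s) * (md k (dist r p) - md k s)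
              + sn k s * (md k (dist r q) - md k (dist p q - s))"
    if per: "below_Dk k ((dist p q + dist q r + dist r p) / 2)" for r
  proof (cases "p = q")
    case True then show ?thesis using s by simp
  next
    case False
    define L a b where "L = dist p q" and "a = dist r p" and "b = dist q r"
    have tri: "0 \<le> a" "0 \<le> b" "0 < L" "a \<le> b + L" "b \<le> a + L" "L \<le> a + b"
      using False dist_triangle[of r p q] dist_triangle[of q r p] dist_triangle[of p q r]
      by (auto simp: L_def a_def b_def dist_commute)
    have "\<exists>P Q R X. {P, Q, R, X} \<subseteq> model_space k \<and> model_dist k P Q = L \<and> model_dist k Q R = b \<and>
    model_dist k R P = a \<and> model_dist k P X = s \<and> model_dist k X Q = L - s \<and>
    sn k L * md k (model_dist k X R) = sn k (L - s) * (md k a - md k s) + sn k s * (md k b - md k (L - s))"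
    proof (cases k "0::real" rule: linorder_cases)
      case less then show ?thesis using tri s L_def by (intro model_triangle_neg) auto
    next
      case equal then show ?thesis using model_triangle_zero[of a b L s] tri s L_def by simp
    next
      case greater then show ?thesis using tri s per L_def a_def b_def by (intro model_triangle_pos) auto
    qed
    then obtain P Q R X where M: "P \<in> model_space k" "Q \<in> model_space k" "R \<in> model_space k" "X \<in> model_space k"
      "model_dist k P Q = L" "model_dist k Q R = b" "model_dist k R P = a" "model_dist k P X = s" "model_dist k X Q = L - s"
      and F: "sn k L * md k (model_dist k X R) = sn k (L - s) * (md k a - md k s) + sn k s * (md k b - md k (L - s))"
      by auto
    \<comment> \<open>A side is at most half the perimeter, so the other two sides are also short
      enough to have geodesics.\<close>
    have hp: "b \<le> (L + b + a) / 2" "a \<le> (L + b + a) / 2" using tri by auto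
    have "below_Dk k b" "below_Dk k a" using below_Dk_mono[OF per] hp by (auto simp: L_def a_def b_def)
    then obtain g2 g3 where g2: "geodesic_seg g2 q r" and g3: "geodesic_seg g3 r p"
      using geo[of q r] geo[of r p] by (auto simp: a_def b_def)
    have g30: "g3 0 = r" using g3 by (simp add: geodesic_seg_def)
    have 1: "(z, X) \<in> side_pairs k g p q P Q"
      using M s by (auto simp: side_pairs_def z_def L_def)
    have "(g3 0, R) \<in> side_pairs k g3 r p R P"
      unfolding side_pairs_def using M model_dist_refl[of R k] by (auto simp: a_def intro!: exI[of _ 0])
    then have 2: "(r, R) \<in> side_pairs k g3 r p R P" using g30 by simp
    have C: "let T = side_pairs k g p q P Q \<union> side_pairs k g2 q r Q R \<union> side_pairs k g3 r p R P
         in \<forall>(x, X)\<in>T. \<forall>(y, Y)\<in>T. dist x y \<le> model_dist k X Y"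
      using assms g g2 g3 per M unfolding CAT_def L_def a_def b_def by blast
    have le: "dist r z \<le> model_dist k X R"
      using C 1 2 unfolding Let_def by (fastforce simp: dist_commute)
    \<comment> \<open>Needed because \<open>md\<close> increases only up to pi / sqrt k.\<close>
    have "model_dist k X R \<le> pi / sqrt k" if "0 < k"
      using that arccos_ubound[of "inner X R"] M(3,4) Cauchy_Schwarz_ineq2[of X R]
      by (auto simp: model_dist_def model_space_def field_simps)
    then have "md k (dist r z) \<le> md k (model_dist k X R)"
      by (intro md_mono le) auto
    moreover have "0 < sn k L" using tri(3) Dk by (intro sn_pos) (auto simp: L_def)
    ultimately have "sn k L * md k (dist r z) \<le> sn k L * md k (model_dist k X R)" by simp
    then show ?thesis unfolding F by (simp add: L_def a_def b_def dist_commute)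
  qed
  ultimately show "\<exists>z. dist p z = s \<and> dist z q = dist p q - s \<and>
       (\<forall>r. below_Dk k ((dist p q + dist q r + dist r p) / 2) \<longrightarrow>
          sn k (dist p q) * md k (dist r z)
            \<le> sn k (dist p q - s) * (md k (dist r p) - md k s)
              + sn k s * (md k (dist r q) - md k (dist p q - s)))" by blast
qed

section \<open>From negative curvature to curvature zero\<close>

text \<open>\<open>G x = cosh (sqrt (x\<^sup>2 + H))\<close> satisfies \<open>G'' \<le> G\<close>, with equality for the left-hand side, so the
  difference cannot have a negative interior minimum.\<close>
lemma cosh_sqrt_ge_interpolant:
  fixes x1 x2 x H \<alpha> \<beta> :: real
  assumes H: "0 < H" and x: "x1 \<le> x" "x \<le> x2"
    and e1: "\<alpha> * cosh x1 + \<beta> * sinh x1 \<le> cosh (sqrt (x1\<^sup>2 + H))"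
    and e2: "\<alpha> * cosh x2 + \<beta> * sinh x2 \<le> cosh (sqrt (x2\<^sup>2 + H))"
  shows "\<alpha> * cosh x + \<beta> * sinh x \<le> cosh (sqrt (x\<^sup>2 + H))"
proof -
  define r where "r = (\<lambda>x. sqrt (x\<^sup>2 + H))"
  have pos: "0 < x\<^sup>2 + H" for x using H by (simp add: add_nonneg_pos)
  have rp: "0 < r x" "(r x)\<^sup>2 = x\<^sup>2 + H" for x using pos[of x] by (auto simp: r_def)
  have dr: "(r has_real_derivative x / r x) (at x)" for x
    unfolding r_def using pos[of x] by (auto intro!: derivative_eq_intros simp: field_simps)
  define F where "F = (\<lambda>x. cosh (r x) - (\<alpha> * cosh x + \<beta> * sinh x))"
  define F' where "F' = (\<lambda>x. sinh (r x) * (x / r x) - (\<alpha> * sinh x + \<beta> * cosh x))"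
  define F'' where "F'' = (\<lambda>x. cosh (r x) * (x / r x)\<^sup>2 + sinh (r x) / r x * (H / (r x)\<^sup>2)
     - (\<alpha> * cosh x + \<beta> * sinh x))"
  have dF: "(F has_real_derivative F' x) (at x)" for x
    unfolding F_def F'_def by (auto intro!: derivative_eq_intros dr)
  have dF': "(F' has_real_derivative F'' x) (at x)" for x
  proof -
    have *: "(1 * r x - x * (x / r x)) / (r x * r x) = H / (r x)\<^sup>2 / r x"
    proof -
      have "1 * r x - x * (x / r x) = ((r x)\<^sup>2 - x\<^sup>2) / r x"
        using rp(1)[of x] by (simp add: field_simps power2_eq_square)
      then show ?thesis using rp(2)[of x] by (simp add: power2_eq_square mult.commute)
    qed
    have d1: "((\<lambda>x. sinh (r x)) has_real_derivative cosh (r x) * (x / r x)) (at x)"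
      by (auto intro!: derivative_eq_intros dr)
    have d2: "((\<lambda>x. x / r x) has_real_derivative (1 * r x - x * (x / r x)) / (r x * r x)) (at x)"
      using rp(1)[of x] by (intro DERIV_divide DERIV_ident dr) simp
    have d3: "((\<lambda>x. \<alpha> * sinh x + \<beta> * cosh x) has_real_derivative \<alpha> * cosh x + \<beta> * sinh x) (at x)"
      by (auto intro!: derivative_eq_intros)
    have "(F' has_real_derivative cosh (r x) * (x / r x) * (x / r x) +
       (1 * r x - x * (x / r x)) / (r x * r x) * sinh (r x) - (\<alpha> * cosh x + \<beta> * sinh x)) (at x)"
      unfolding F'_def by (intro DERIV_diff DERIV_mult d1 d2 d3)
    moreover have "cosh (r x) * (x / r x) * (x / r x) + H / (r x)\<^sup>2 / r x * sinh (r x)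
        - (\<alpha> * cosh x + \<beta> * sinh x) = F'' x"
      by (simp add: F''_def power2_eq_square ac_simps)
    ultimately show ?thesis unfolding * by simp
  qed
  have F''_le: "F'' x \<le> F x" for x
  proof -
    \<comment> \<open>The weights (x / r)^2 and H / r^2 in \<open>F''\<close> add up to 1, so
      replacing sinh r / r by the larger cosh r turns the first two terms into cosh r.\<close>
    have "sinh (r x) \<le> r x * cosh (r x)"
    proof -
      have "\<exists>y. ((\<lambda>t. t * cosh t - sinh t) has_real_derivative y) (at t) \<and> 0 \<le> y" if "0 \<le> t" for t :: real
        using that by (intro exI[of _ "t * sinh t"]) (auto intro!: derivative_eq_intros)
      from DERIV_nonneg_imp_nondecreasing[of 0 "r x", OF _ this] have
        "0 * cosh 0 - sinh 0 \<le> r x * cosh (r x) - sinh (r x)" using rp(1)[of x] by simp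
      then show ?thesis by simp
    qed
    then have "sinh (r x) / r x \<le> cosh (r x)" using rp(1)[of x] by (simp add: divide_le_eq mult.commute)
    then have "sinh (r x) / r x * (H / (r x)\<^sup>2) \<le> cosh (r x) * (H / (r x)\<^sup>2)"
      using H by (intro mult_right_mono) auto
    moreover have "cosh (r x) * (x / r x)\<^sup>2 + cosh (r x) * (H / (r x)\<^sup>2) = cosh (r x) * ((x\<^sup>2 + H) / (r x)\<^sup>2)"
      by (simp add: power_divide add_divide_distrib distrib_left)
    moreover have "(x\<^sup>2 + H) / (r x)\<^sup>2 = 1" using rp[of x] pos[of x] by simp
    ultimately show ?thesis by (simp add: F''_def F_def)
  qed
  have "continuous_on {x1..x2} F" using dF DERIV_isCont continuous_at_imp_continuous_on by blast
  then obtain m where m: "x1 \<le> m" "m \<le> x2" "\<forall>y\<in>{x1..x2}. F m \<le> F y"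
    using continuous_attains_inf[of "{x1..x2}" F] x by auto
  have "0 \<le> F m"
  proof (rule ccontr)
    assume n: "\<not> 0 \<le> F m"
    then have "m \<noteq> x1" "m \<noteq> x2" using e1 e2 by (auto simp: F_def r_def)
    then have mi: "x1 < m" "m < x2" using m by auto
    define d where "d = min (m - x1) (x2 - m)"
    have "F' m = 0"
    proof (rule DERIV_local_min[OF dF[of m], of d])
      show "0 < d" using mi by (simp add: d_def)
      show "\<forall>y. \<bar>m - y\<bar> < d \<longrightarrow> F m \<le> F y" using m(3) by (auto simp: d_def abs_if split: if_splits)
    qed
    \<comment> \<open>At a negative minimum F'' <= F < 0, so F' is negative just to the right of m
      and F falls below its minimum.\<close>
    have "F'' m < 0" using F''_le[of m] n by linarith
    from DERIV_neg_dec_right[OF dF' this] obtain e where e: "0 < e" "\<And>h. 0 < h \<Longrightarrow> h < e \<Longrightarrow> F' (m + h) < F' m"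
      by auto
    define h where "h = min (e / 2) (d / 2)"
    have h: "0 < h" "h < e" "m + h \<le> x2"
    proof -
      have "h \<le> e / 2" "h \<le> d / 2" "d \<le> x2 - m"
        by (simp_all only: h_def d_def min.cobounded1 min.cobounded2)
      then show "h < e" "m + h \<le> x2" using e(1) mi by (simp_all add: field_simps)
      show "0 < h" using e(1) mi by (simp add: h_def d_def)
    qed
    have "F (m + h) < F m"
    proof (rule DERIV_neg_imp_decreasing_open[of m "m + h" F])
      show "m < m + h" using h by simp
      show "\<exists>y. DERIV F x :> y \<and> y < 0" if "m < x" "x < m + h" for x
        using dF[of x] e(2)[of "x - m"] that h \<open>F' m = 0\<close> by (intro exI[of _ "F' x"]) auto
      show "continuous_on {m..m + h} F" using dF DERIV_isCont continuous_at_imp_continuous_on by blast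
    qed
    moreover have "m + h \<in> {x1..x2}" using h m by auto
    ultimately show False using m(3) by fastforce
  qed
  also have "F m \<le> F x" using m(3) x by auto
  finally have "0 \<le> F x" .
  then show ?thesis by (simp add: F_def r_def)
qed

text \<open>\<open>q\<close> is the squared length of the Euclidean cevian, written \<open>(s - t0)\<^sup>2 + H\<close> with \<open>t0\<close>, \<open>H\<close>
  the foot and the squared length of the altitude.\<close>
lemma cosh_sqrt_stewart:
  fixes a b L s q :: real
  assumes "0 \<le> a" "0 \<le> b" "0 < L" "a \<le> b + L" "b \<le> a + L" "L \<le> a + b" "0 \<le> s" "s \<le> L"
    and q: "L * q = (L - s) * a\<^sup>2 + s * b\<^sup>2 - s * (L - s) * L"
  shows "0 \<le> q \<and> sinh (L - s) * cosh a + sinh s * cosh b \<le> sinh L * cosh (sqrt q)"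
proof -
  define t0 where "t0 = (a\<^sup>2 + L\<^sup>2 - b\<^sup>2) / (2 * L)"
  have Lc: "2 * L * t0 = a\<^sup>2 + L\<^sup>2 - b\<^sup>2" using assms by (simp add: t0_def)
  have "t0 \<le> a"
  proof -
    have "(a - L)\<^sup>2 \<le> b\<^sup>2" using assms by (intro abs_le_square_iff[THEN iffD1]) auto
    then have "L * t0 \<le> L * a" using Lc by (simp add: power2_eq_square algebra_simps)
    then show ?thesis using assms by simp
  qed
  moreover have "- a \<le> t0"
  proof -
    have "b\<^sup>2 \<le> (a + L)\<^sup>2" using assms by (intro abs_le_square_iff[THEN iffD1]) auto
    then have "L * (- a) \<le> L * t0" using Lc by (simp add: power2_eq_square algebra_simps)
    then show ?thesis using mult_le_cancel_left_pos[OF \<open>0 < L\<close>] by blast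
  qed
  ultimately have "t0\<^sup>2 \<le> a\<^sup>2" by (intro abs_le_square_iff[THEN iffD1]) auto
  define H where "H = a\<^sup>2 - t0\<^sup>2"
  have H: "0 \<le> H" using \<open>t0\<^sup>2 \<le> a\<^sup>2\<close> by (simp add: H_def)
  have a2: "a = sqrt ((- t0)\<^sup>2 + H)" using assms by (simp add: H_def)
  have "b\<^sup>2 = (L - t0)\<^sup>2 + H" using Lc unfolding H_def by algebra
  then have b2: "b = sqrt ((L - t0)\<^sup>2 + H)" using assms by (metis real_sqrt_unique)
  have "2 * (L * q) = 2 * (L * ((s - t0)\<^sup>2 + H))" unfolding q H_def using Lc by algebra
  then have q2: "q = (s - t0)\<^sup>2 + H" using \<open>0 < L\<close> by (simp only: mult_cancel_left) simp
  then have q0: "0 \<le> q" using H by simp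
  have sh: "sinh (L - s) * cosh (- t0) + sinh s * cosh (L - t0) = sinh L * cosh (s - t0)"
    by (simp add: sinh_diff cosh_diff algebra_simps)
  have "sinh (L - s) * cosh a + sinh s * cosh b \<le> sinh L * cosh (sqrt q)"
  \<comment> \<open>A flat triangle is treated apart: there the square root is not differentiable at
    the foot, and \<open>sh\<close> gives equality.\<close>
  proof (cases "H = 0")
    case True
    then show ?thesis using sh unfolding a2 b2 q2 by simp
  next
    case False
    with H have "0 < H" by simp
    \<comment> \<open>The combination of cosh and sinh with the values cosh a at 0 and cosh b at L.
      Below, \<alpha> and \<beta> are its coefficients after moving the origin to the foot of the
      altitude.\<close>
    define \<alpha>' \<beta>' where "\<alpha>' = cosh a" and "\<beta>' = (cosh b - cosh a * cosh L) / sinh L"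
    have "0 < sinh L" using assms by simp
    then have bL: "\<alpha>' * cosh L + \<beta>' * sinh L = cosh b" by (simp add: \<alpha>'_def \<beta>'_def)
    define \<alpha> \<beta> where "\<alpha> = \<alpha>' * cosh t0 + \<beta>' * sinh t0" and "\<beta> = \<alpha>' * sinh t0 + \<beta>' * cosh t0"
    have sft: "\<alpha> * cosh (x - t0) + \<beta> * sinh (x - t0) = \<alpha>' * cosh x + \<beta>' * sinh x" for x
    proof -
      have "\<alpha> * cosh (x - t0) + \<beta> * sinh (x - t0)
          = (\<alpha>' * cosh x + \<beta>' * sinh x) * ((cosh t0)\<^sup>2 - (sinh t0)\<^sup>2)"
        unfolding \<alpha>_def \<beta>_def sinh_diff cosh_diff by (simp add: power2_eq_square algebra_simps)
      then show ?thesis by (simp add: cosh_square_eq)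
    qed
    have "\<alpha> * cosh (s - t0) + \<beta> * sinh (s - t0) \<le> cosh (sqrt ((s - t0)\<^sup>2 + H))"
    proof (rule cosh_sqrt_ge_interpolant[OF \<open>0 < H\<close>, of "0 - t0" _ "L - t0"])
      show "\<alpha> * cosh (0 - t0) + \<beta> * sinh (0 - t0) \<le> cosh (sqrt ((0 - t0)\<^sup>2 + H))"
        unfolding sft using a2 by (simp add: \<alpha>'_def)
      show "\<alpha> * cosh (L - t0) + \<beta> * sinh (L - t0) \<le> cosh (sqrt ((L - t0)\<^sup>2 + H))"
        unfolding sft bL using b2 by simp
    qed (use assms(7,8) in auto)
    then have "\<alpha>' * cosh s + \<beta>' * sinh s \<le> cosh (sqrt q)" unfolding sft q2 .
    then have "sinh L * (\<alpha>' * cosh s + \<beta>' * sinh s) \<le> sinh L * cosh (sqrt q)"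
      using \<open>0 < sinh L\<close> by simp
    moreover have "sinh L * (\<alpha>' * cosh s + \<beta>' * sinh s) = sinh (L - s) * cosh a + sinh s * cosh b"
      unfolding bL[symmetric] by (simp add: \<alpha>'_def sinh_diff algebra_simps)
    ultimately show ?thesis by simp
  qed
  with q0 show ?thesis by blast
qed

section \<open>Circumcenters\<close>

lemma below_DkD: "below_Dk k a \<Longrightarrow> b \<le> a \<Longrightarrow> 0 < k \<Longrightarrow> b \<le> pi / sqrt k"
  by (simp add: below_Dk_def)

text \<open>The hyperbolic cevian is at most the Euclidean one of the triangle with the same sides.
  That is \<open>cosh_sqrt_stewart\<close> with all lengths scaled by \<open>u\<close>; the same
  point z works for both curvatures.\<close>

lemma stewart_neg_imp_zero:
  assumes k: "k < 0" and st: "stewart k TYPE('a::metric_space)"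
  shows "stewart 0 TYPE('a)"
  unfolding stewart_def
proof (intro allI impI)
  fix p q :: 'a and s
  assume s: "0 \<le> s" "s \<le> dist p q"
  define L where "L = dist p q"
  obtain z where z: "dist p z = s" "dist z q = L - s"
    and I: "\<And>r. sn k L * md k (dist r z) \<le> sn k (L - s) * (md k (dist r p) - md k s)
              + sn k s * (md k (dist r q) - md k (L - s))"
    using st s k unfolding stewart_def below_Dk_def L_def by (metis less_eq_real_def)
  have "sn 0 L * md 0 (dist r z) \<le> sn 0 (L - s) * (md 0 (dist r p) - md 0 s)
              + sn 0 s * (md 0 (dist r q) - md 0 (L - s))" for r
  proof (cases "L = 0")
    case True then show ?thesis using s by (simp add: L_def)
  next
    case False
    define a b m u where "a = dist r p" and "b = dist r q" and "m = dist r z" and "u = sqrt (-k)"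
    have u: "0 < u" "u * u = -k" using k by (auto simp: u_def)
    have L: "0 < L" using False by (simp add: L_def)
    have tri: "0 \<le> a" "0 \<le> b" "a \<le> b + L" "b \<le> a + L" "L \<le> a + b"
      using dist_triangle[of r p q] dist_triangle[of r q p] dist_triangle[of p q r]
      by (auto simp: L_def a_def b_def dist_commute)
    \<comment> \<open>Multiplication by k < 0 reverses the inequality and turns \<open>md\<close>
      into \<open>cs\<close>.\<close>
    have "k * (sn k (L - s) * (md k a - md k s) + sn k s * (md k b - md k (L - s))) \<le> k * (sn k L * md k m)"
      using I[of r] k unfolding a_def b_def m_def by simp
    then have "sn k (L - s) * (k * md k a - k * md k s) + sn k s * (k * md k b - k * md k (L - s)) \<le> sn k L * (k * md k m)"
      by (simp add: algebra_simps)
    moreover have "sn k L = sn k (L - s) * cs k s + sn k s * cs k (L - s)"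
      using sn_add[of k "L - s" s] by simp
    ultimately have 1: "sn k L * cs k m \<le> sn k (L - s) * cs k a + sn k s * cs k b"
      unfolding md_cs by (simp add: right_diff_distrib)
    have sc: "sn k x = sinh (u * x) / u" "cs k x = cosh (u * x)" for x
      using k by (auto simp: sn_def cs_def u_def)
    have 2: "sinh (u * L) * cosh (u * m) \<le> sinh (u * L - u * s) * cosh (u * a) + sinh (u * s) * cosh (u * b)"
      using 1 u(1) unfolding sc by (simp add: right_diff_distrib divide_le_cancel flip: add_divide_distrib)
    \<comment> \<open>The squared Euclidean cevian, from Stewart's theorem.\<close>
    define q' where "q' = ((L - s) * a\<^sup>2 + s * b\<^sup>2 - s * (L - s) * L) / L"
    have Lq: "L * q' = (L - s) * a\<^sup>2 + s * b\<^sup>2 - s * (L - s) * L" using L by (simp add: q'_def)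
    have "0 \<le> u\<^sup>2 * q' \<and> sinh (u * L - u * s) * cosh (u * a) + sinh (u * s) * cosh (u * b)
         \<le> sinh (u * L) * cosh (sqrt (u\<^sup>2 * q'))"
    proof (rule cosh_sqrt_stewart)
      have "u^3 * (L * q') = u^3 * ((L - s) * a\<^sup>2 + s * b\<^sup>2 - s * (L - s) * L)" by (simp only: Lq)
      then show "u * L * (u\<^sup>2 * q') = (u * L - u * s) * (u * a)\<^sup>2 + u * s * (u * b)\<^sup>2 - u * s * (u * L - u * s) * (u * L)"
        by (simp add: power2_eq_square power3_eq_cube algebra_simps)
    qed (use u(1) L tri s L_def in \<open>auto simp flip: distrib_left\<close>)
    with 2 have "0 \<le> u\<^sup>2 * q'" "sinh (u * L) * cosh (u * m) \<le> sinh (u * L) * cosh (sqrt (u\<^sup>2 * q'))" by auto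
    then have "cosh (u * m) \<le> cosh (sqrt (u\<^sup>2 * q'))" using u L by simp
    then have "u * m \<le> sqrt (u\<^sup>2 * q')"
      using cosh_real_nonneg_le_iff[of "u * m" "sqrt (u\<^sup>2 * q')"] \<open>0 \<le> u\<^sup>2 * q'\<close> u by (simp add: m_def)
    then have "m \<le> sqrt q'" using u by (simp add: real_sqrt_mult)
    moreover have "0 \<le> q'" using \<open>0 \<le> u\<^sup>2 * q'\<close> u by (simp add: zero_le_mult_iff)
    ultimately have "m\<^sup>2 \<le> q'" using sqrt_ge_absD[of m q'] by (simp add: m_def)
    then have "L * m\<^sup>2 \<le> L * q'" using L by simp
    then show ?thesis unfolding Lq
      by (simp add: sn_def md_def power2_eq_square field_simps flip: a_def b_def m_def)
  qed
  with z show "\<exists>z. dist p z = s \<and> dist z q = dist p q - s \<and>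
       (\<forall>r. below_Dk 0 ((dist p q + dist q r + dist r p) / 2) \<longrightarrow>
          sn 0 (dist p q) * md 0 (dist r z)
            \<le> sn 0 (dist p q - s) * (md 0 (dist r p) - md 0 s)
              + sn 0 s * (md 0 (dist r q) - md 0 (dist p q - s)))"
    unfolding L_def by blast
qed

lemma CAT_imp_stewart_max:
  assumes "CAT k TYPE('a::metric_space)" shows "stewart (max k 0) TYPE('a)"
  using CAT_imp_stewart[OF assms] stewart_neg_imp_zero[of k]
  by (cases "k < 0") (auto simp: max_def)

section \<open>Circumradius and circumcenter of a compact set\<close>

lemma bdd_above_dist:
  fixes X :: "'a::metric_space set" assumes "compact X" shows "bdd_above ((\<lambda>x. dist x z) ` X)"
  using assms by (intro bounded_imp_bdd_above compact_imp_bounded compact_continuous_image)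
    (auto intro!: continuous_intros)

lemma circumradius_le:
  fixes X :: "'a::metric_space set" assumes "compact X" "X \<noteq> {}"
  shows "circumradius X \<le> (SUP x\<in>X. dist x z)"
  unfolding circumradius_def
proof (rule cINF_lower)
  obtain x where "x \<in> X" using assms by blast
  then have "0 \<le> (SUP x\<in>X. dist x z)" for z
    by (rule cSUP_upper2[OF bdd_above_dist[OF assms(1)]]) simp
  then show "bdd_below (range (\<lambda>z. SUP x\<in>X. dist x z))" by (intro bdd_belowI2)
qed simp

lemma ex_dist_ge_circumradius:
  fixes X :: "'a::metric_space set" assumes "compact X" "X \<noteq> {}"
  shows "\<exists>x\<in>X. circumradius X \<le> dist x z"
proof -
  have "\<exists>x\<in>X. \<forall>y\<in>X. dist y z \<le> dist x z"
    using assms by (intro continuous_attains_sup) (auto intro!: continuous_intros)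
  then obtain x where x: "x \<in> X" "\<And>y. y \<in> X \<Longrightarrow> dist y z \<le> dist x z" by blast
  then have "(SUP x\<in>X. dist x z) \<le> dist x z" using assms by (intro cSUP_least) auto
  with x circumradius_le[OF assms, of z] show ?thesis by force
qed

lemma circumradius_le_cball:
  fixes X :: "'a::metric_space set" assumes "compact X" "X \<noteq> {}" "\<And>x. x \<in> X \<Longrightarrow> dist x z \<le> \<rho>"
  shows "circumradius X \<le> \<rho>"
  using ex_dist_ge_circumradius[OF assms(1,2), of z] assms(3) by force

lemma circumradius_nonneg:
  fixes X :: "'a::metric_space set" assumes "compact X" "X \<noteq> {}"
  shows "0 \<le> circumradius X"
  unfolding circumradius_def
proof (rule cINF_greatest)
  obtain x where x: "x \<in> X" using assms by blast
  show "0 \<le> (SUP x\<in>X. dist x z)" for z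
    by (rule cSUP_upper2[OF bdd_above_dist[OF assms(1)] x]) simp
qed simp

lemma ex_near_circumcenter:
  fixes X :: "'a::metric_space set" assumes "compact X" "X \<noteq> {}" "circumradius X < \<rho>"
  shows "\<exists>z. \<forall>x\<in>X. dist x z \<le> \<rho>"
proof (rule ccontr)
  assume "\<not> ?thesis"
  then have "\<rho> \<le> (SUP x\<in>X. dist x z)" for z
    using cSUP_upper2[OF bdd_above_dist[OF assms(1)], of _ \<rho> z] by (metis linorder_le_cases)
  then have "\<rho> \<le> circumradius X" unfolding circumradius_def by (intro cINF_greatest) auto
  with assms show False by simp
qed

locale small_compact =
  fixes k :: real and X :: "'a::complete_space set"
  assumes k_nonneg: "0 \<le> k" and st: "stewart k TYPE('a)"
    and cpt: "compact X" and ne: "X \<noteq> {}"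
    and small: "0 < k \<Longrightarrow> \<exists>c r. r < pi / (2 * sqrt k) \<and> X \<subseteq> ball c r"
begin

abbreviation R where "R \<equiv> circumradius X"

lemma R_nonneg: "0 \<le> R"
  by (rule circumradius_nonneg[OF cpt ne])

lemma below_2R: "below_Dk k (2 * R)"
proof (cases "k = 0")
  case False
  then have "0 < k" using k_nonneg by simp
  from small[OF this] obtain c r where c: "r < pi / (2 * sqrt k)" "X \<subseteq> ball c r" by blast
  then have "R \<le> r"
    by (intro circumradius_le_cball[OF cpt ne, of c]) (auto simp: dist_commute less_eq_real_def)
  with c(1) have "2 * R < 2 * (pi / (2 * sqrt k))" by simp
  then show ?thesis by (simp add: below_Dk_def)
qed (simp add: below_Dk_def)

lemma cs_R: "0 < cs k R"
  using cs_pos R_nonneg below_2R by blast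

lemma ex_below_2_gt_R: "\<exists>\<rho>>R. below_Dk k (2 * \<rho>)"
proof (cases "k = 0")
  case False
  with k_nonneg have "0 < k" by simp
  then obtain d where "2 * R < d" "d < pi / sqrt k"
    using below_2R dense[of "2 * R" "pi / sqrt k"] by (auto simp: below_Dk_def)
  then show ?thesis by (intro exI[of _ "d / 2"]) (auto simp: below_Dk_def)
qed (auto simp: below_Dk_def intro!: exI[of _ "R + 1"])

text \<open>Some point of X is at distance at least R from the midpoint of z1 and z2, while the
  comparison at the midpoint puts X closer to it the farther z1 and z2 are apart. The case \<rho> =
  R gives uniqueness; \<rho> tending to R makes almost optimal centers a Cauchy sequence.\<close>

lemma two_centers:
  assumes 1: "\<And>x. x \<in> X \<Longrightarrow> dist x z1 \<le> \<rho>" and 2: "\<And>x. x \<in> X \<Longrightarrow> dist x z2 \<le> \<rho>"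
    and below: "below_Dk k (2 * \<rho>)"
  shows "md k (dist z1 z2 / 2) * cs k R \<le> md k \<rho> - md k R"
proof (cases "z1 = z2")
  case True
  have "R \<le> \<rho>" using circumradius_le_cball[OF cpt ne 1] .
  then have "md k R \<le> md k \<rho>" using R_nonneg by (intro md_mono below_DkD[OF below]) auto
  then show ?thesis using True by simp
next
  case False
  define L where "L = dist z1 z2"
  obtain x0 where "x0 \<in> X" using ne by blast
  then have L: "0 < L" "L \<le> 2 * \<rho>"
    using False 1 2 dist_triangle3[of z1 z2 x0] by (force simp: L_def)+
  then have "below_Dk k L" using below_Dk_mono[OF below] by blast
  with st L obtain z where z: "dist z1 z = L / 2" "dist z z2 = L - L / 2" and
    I: "\<And>r. below_Dk k ((L + dist z2 r + dist r z1) / 2) \<Longrightarrow>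
         sn k L * md k (dist r z) \<le> sn k (L - L / 2) * (md k (dist r z1) - md k (L / 2))
              + sn k (L / 2) * (md k (dist r z2) - md k (L - L / 2))"
    unfolding stewart_def L_def by (metis field_sum_of_halves le_add_same_cancel1 less_eq_real_def half_gt_zero_iff)
  obtain x where x: "x \<in> X" "R \<le> dist x z" using ex_dist_ge_circumradius[OF cpt ne] by blast
  define a b where "a = dist x z1" and "b = dist x z2"
  have ab: "0 \<le> a" "0 \<le> b" "a \<le> \<rho>" "b \<le> \<rho>" using 1 2 x by (auto simp: a_def b_def)
  have "(L + dist z2 x + dist x z1) / 2 \<le> 2 * \<rho>" using ab L(2) by (auto simp: a_def b_def dist_commute)
  from I[OF below_Dk_mono[OF below this]]
  have 3: "sn k L * md k (dist x z) \<le> sn k (L / 2) * (md k a + md k b - 2 * md k (L / 2))"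
    by (simp add: a_def b_def algebra_simps)
  have up: "0 < k \<Longrightarrow> 2 * \<rho> \<le> pi / sqrt k" using below by (simp add: below_Dk_def)
  have "dist x z \<le> 2 * \<rho>"
    using dist_triangle[of x z z1] z ab L by (simp add: a_def dist_commute)
  then have "md k R \<le> md k (dist x z)" using x R_nonneg up by (intro md_mono) auto
  moreover have "0 < sn k L" using L \<open>below_Dk k L\<close> by (intro sn_pos) auto
  ultimately have "sn k L * md k R \<le> sn k L * md k (dist x z)" by simp
  moreover have "md k a \<le> md k \<rho>" "md k b \<le> md k \<rho>" using ab up by (auto intro!: md_mono)
  moreover have sl: "0 < sn k (L / 2)" using L below_Dk_mono[OF \<open>below_Dk k L\<close>] by (intro sn_pos) auto
  ultimately have "sn k L * md k R \<le> sn k (L / 2) * (2 * (md k \<rho> - md k (L / 2)))"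
    using 3 by (smt (verit) mult_left_mono)
  moreover have "sn k L = sn k (L / 2) * (2 * cs k (L / 2))" using sn_half_cs[of k L] by simp
  ultimately have "cs k (L / 2) * md k R \<le> md k \<rho> - md k (L / 2)"
    using sl by (simp add: mult.assoc)
  then have "(1 - k * md k (L / 2)) * md k R \<le> md k \<rho> - md k (L / 2)" by (simp add: md_cs)
  then have "md k (L / 2) * (1 - k * md k R) \<le> md k \<rho> - md k R" by (simp add: algebra_simps)
  then have "md k (L / 2) * cs k R \<le> md k \<rho> - md k R" by (simp add: md_cs)
  then show ?thesis by (simp add: L_def)
qed

lemma circumcenter_unique:
  assumes "circumcenter X y1" "circumcenter X y2" shows "y1 = y2"
proof (rule ccontr)
  assume n: "y1 \<noteq> y2"
  have d: "dist x y1 \<le> R" "dist x y2 \<le> R" if "x \<in> X" for x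
    using assms that by (auto simp: circumcenter_def dist_commute)
  have "md k (dist y1 y2 / 2) * cs k R \<le> 0" using two_centers[OF d below_2R] by simp
  moreover obtain x where "x \<in> X" using ne by blast
  then have "dist y1 y2 / 2 \<le> R" using d[of x] dist_triangle3[of y1 y2 x] by simp
  then have "0 < md k (dist y1 y2 / 2)"
    using md_strict_mono[of 0 "dist y1 y2 / 2" k, OF _ _ below_DkD[OF below_2R]] n R_nonneg by simp
  ultimately show False using cs_R by (simp add: mult_le_0_iff)
qed

lemma ex_circumcenter: "\<exists>y. circumcenter X y"
proof -
  obtain \<rho>0 where r0: "R < \<rho>0" "below_Dk k (2 * \<rho>0)" using ex_below_2_gt_R by blast
  define \<rho> where "\<rho> = (\<lambda>n::nat. R + (\<rho>0 - R) / (real n + 1))"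
  have \<rho>: "R < \<rho> n" "\<rho> n \<le> \<rho>0" for n
  proof -
    have "(\<rho>0 - R) / (real n + 1) \<le> (\<rho>0 - R) / 1" using r0 by (intro divide_left_mono) auto
    then show "R < \<rho> n" "\<rho> n \<le> \<rho>0" using r0 by (auto simp: \<rho>_def)
  qed
  have anti: "\<rho> n \<le> \<rho> m" if "m \<le> n" for m n
    using r0 that by (auto simp: \<rho>_def intro!: divide_left_mono)
  have lim: "\<rho> \<longlonglongrightarrow> R"
    unfolding \<rho>_def by real_asymp
  have bel: "below_Dk k (2 * \<rho> n)" for n using below_Dk_mono[OF r0(2)] \<rho> by simp
  have "\<forall>n. \<exists>z. \<forall>x\<in>X. dist x z \<le> \<rho> n" using ex_near_circumcenter[OF cpt ne \<rho>(1)] by blast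
  then obtain z where z: "\<And>n x. x \<in> X \<Longrightarrow> dist x (z n) \<le> \<rho> n" by metis
  have "Cauchy z"
  proof (rule metric_CauchyI)
    fix e :: real assume "0 < e"
    \<comment> \<open>Capped by \<open>\<rho>0\<close> so that e' / 2 lies where \<open>md\<close>
      is increasing.\<close>
    define e' where "e' = min e \<rho>0"
    have e': "0 < e'" "e' \<le> e" "e' \<le> \<rho>0" using \<open>0 < e\<close> r0 R_nonneg by (auto simp: e'_def)
    have up: "0 < k \<Longrightarrow> 2 * \<rho>0 < pi / sqrt k" using r0 by (simp add: below_Dk_def)
    have "0 < md k (e' / 2)" using md_strict_mono[of 0 "e'/2" k, OF _ _ below_DkD[OF r0(2)]] e' by simp
    then have pos: "0 < md k (e' / 2) * cs k R" using cs_R by simp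
    have "(\<lambda>n. md k (\<rho> n)) \<longlonglongrightarrow> md k R" using isCont_tendsto_compose[OF isCont_md lim] .
    then have "\<forall>\<^sub>F n in sequentially. md k (\<rho> n) < md k R + md k (e' / 2) * cs k R"
      using pos by (intro order_tendstoD(2)) auto
    then obtain N where N: "md k (\<rho> N) < md k R + md k (e' / 2) * cs k R"
      by (auto simp: eventually_sequentially)
    show "\<exists>M. \<forall>m\<ge>M. \<forall>n\<ge>M. dist (z m) (z n) < e"
    proof (intro exI[of _ N] allI impI)
      fix m n assume mn: "m \<ge> N" "n \<ge> N"
      have d: "dist x (z m) \<le> \<rho> N" "dist x (z n) \<le> \<rho> N" if "x \<in> X" for x
        using z[OF that] anti mn by (meson order_trans)+
      have "md k (dist (z m) (z n) / 2) * cs k R < md k (e' / 2) * cs k R"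
        using two_centers[OF d bel] N by simp
      then have lt: "md k (dist (z m) (z n) / 2) < md k (e' / 2)" using cs_R by simp
      obtain x where "x \<in> X" using ne by blast
      have le: "dist (z m) (z n) / 2 \<le> \<rho>0"
        using d[OF \<open>x \<in> X\<close>] \<rho>(2)[of N] dist_triangle3[of "z m" "z n" x] by simp
      show "dist (z m) (z n) < e"
      proof (rule ccontr)
        assume "\<not> dist (z m) (z n) < e"
        then have "md k (e' / 2) \<le> md k (dist (z m) (z n) / 2)"
          by (intro md_mono below_DkD[OF r0(2)]) (use e' le r0 R_nonneg in linarith)+
        with lt show False by simp
      qed
    qed
  qed
  then obtain y where y: "z \<longlonglongrightarrow> y" using Cauchy_convergent convergent_def by blast
  have "dist x y \<le> R" if "x \<in> X" for x
    using LIMSEQ_le[OF tendsto_dist[OF tendsto_const y] lim] z[OF that] by blast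
  then show ?thesis by (intro exI[of _ y]) (auto simp: circumcenter_def dist_commute)
qed

end

section \<open>Measures of large variance\<close>

text \<open>The two arguments are the lengths of complementary arcs of a great circle.\<close>

lemma md_reflect:
  assumes "0 < k" shows "md k (2 * pi / sqrt k - t) = md k t"
proof -
  have "sqrt k * ((2 * pi / sqrt k - t) / 2) = pi - sqrt k * (t / 2)" using assms by (simp add: field_simps)
  then have "sin (sqrt k * ((2 * pi / sqrt k - t) / 2)) = sin (sqrt k * (t / 2))" by (simp only: sin_pi_minus)
  moreover have "sn k r = sin (sqrt k * r) / sqrt k" for r using assms by (simp add: sn_def)
  ultimately have "sn k ((2 * pi / sqrt k - t) / 2) = sn k (t / 2)" by (simp only:)
  then show ?thesis by (simp add: md_def)
qed

text \<open>For k >= 0 the function \<open>sn\<close> is concave up to pi / sqrt k, so sn t / t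
  decreases; the products also admit a = 0.\<close>

lemma sn_ratio_antimono:
  assumes k: "0 \<le> k" and ab: "0 \<le> a" "a \<le> b" "0 < b" and b: "0 < k \<Longrightarrow> b \<le> pi / sqrt k"
  shows "a * sn k b \<le> b * sn k a"
proof -
  define l where "l = a / b"
  have l: "0 \<le> l" "l \<le> 1" "l * b = a" using ab by (auto simp: l_def)
  define f where "f = (\<lambda>t. sn k (l * t) - l * sn k t)"
  have "f 0 \<le> f b"
  proof (rule DERIV_nonneg_imp_nondecreasing[of 0 b f])
    fix t assume t: "0 \<le> t" "t \<le> b"
    have "(f has_real_derivative l * (cs k (l * t) - cs k t)) (at t)"
      unfolding f_def by (auto intro!: derivative_eq_intros DERIV_chain2[OF has_derivative_sn] simp: algebra_simps)
    moreover have "md k (l * t) \<le> md k t"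
      using t l b by (intro md_mono) (auto intro: mult_left_le_one_le)
    then have "k * md k (l * t) \<le> k * md k t" using k by (simp add: mult_left_mono)
    then have "cs k t \<le> cs k (l * t)" by (simp add: md_cs)
    ultimately show "\<exists>y. (f has_real_derivative y) (at t) \<and> 0 \<le> y" using l by (intro exI) auto
  qed (use ab in auto)
  then have "l * sn k b \<le> sn k a" by (simp add: f_def l)
  then have "b * (l * sn k b) \<le> b * sn k a" using ab by simp
  then show ?thesis using l by (metis mult.assoc mult.commute)
qed

text \<open>The tangent-line bound of the convex function sending \<open>md k t\<close> to \<open>t\<^sup>2\<close>.\<close>
lemma square_diff_ge_md:
  assumes k: "0 \<le> k" and r: "0 < r" "below_Dk k r" and t: "0 \<le> t" "0 < k \<Longrightarrow> t \<le> pi / sqrt k"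
  shows "2 * r / sn k r * (md k t - md k r) \<le> t\<^sup>2 - r\<^sup>2"
proof -
  have sr: "0 < sn k r" using sn_pos r by blast
  define f where "f = (\<lambda>t. t\<^sup>2 - 2 * r / sn k r * md k t)"
  have d: "(f has_real_derivative 2 / sn k r * (x * sn k r - r * sn k x)) (at x)" for x
    unfolding f_def using sr by (auto intro!: derivative_eq_intros has_derivative_md simp: field_simps)
  have "f r \<le> f t"
  proof (cases "r \<le> t")
    case True
    then show ?thesis
    proof (rule DERIV_nonneg_imp_nondecreasing)
      fix x assume "r \<le> x" "x \<le> t"
      then have "r * sn k x \<le> x * sn k r" using r t by (intro sn_ratio_antimono k) auto
      then show "\<exists>y. (f has_real_derivative y) (at x) \<and> 0 \<le> y" using d sr by (intro exI conjI) auto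
    qed
  next
    case False
    then have "t \<le> r" by simp
    then show ?thesis
    proof (rule DERIV_nonpos_imp_nonincreasing)
      fix x assume "t \<le> x" "x \<le> r"
      then have "x * sn k r \<le> r * sn k x" using r t by (intro sn_ratio_antimono k) (auto simp: below_Dk_def)
      then show "\<exists>y. (f has_real_derivative y) (at x) \<and> y \<le> 0" using d sr
        by (intro exI conjI) (auto simp: mult_le_0_iff divide_le_0_iff)
    qed
  qed
  then show ?thesis by (simp add: f_def right_diff_distrib)
qed

text \<open>\<open>md\<close> is convex up to r, so its slope \<open>sn k r\<close> at the right end
  bounds the increment.\<close>

lemma md_diff_le:
  assumes "0 \<le> k" "0 \<le> h" "h \<le> r" "below_Dk k (2 * r)"
  shows "md k r - md k (r - h) \<le> h * sn k r"
proof -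
  define f where "f = (\<lambda>t. md k t - t * sn k r)"
  have "f r \<le> f (r - h)"
  proof (rule DERIV_nonpos_imp_nonincreasing[of "r - h" r f])
    fix x assume x: "r - h \<le> x" "x \<le> r"
    have "(f has_real_derivative sn k x - sn k r) (at x)"
      unfolding f_def by (auto intro!: derivative_eq_intros has_derivative_md)
    moreover have "sn k x \<le> sn k r" using x assms by (intro sn_mono) auto
    ultimately show "\<exists>y. (f has_real_derivative y) (at x) \<and> y \<le> 0" by (intro exI) auto
  qed (use assms in auto)
  then show ?thesis by (simp add: f_def algebra_simps)
qed

text \<open>If the triangle is too large for the comparison, then \<open>d(w,q)\<close> exceeds the distance \<open>\<beta>\<close>
  for which \<open>w\<close>, \<open>p\<close>, \<open>q\<close> lie on a great circle of the model sphere.\<close>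
lemma stewart_truncated:
  assumes st: "stewart k TYPE('a::metric_space)" and k: "0 \<le> k"
    and L: "below_Dk k (dist (p::'a) q)" and s: "0 \<le> s" "s \<le> dist p q"
  shows "\<exists>z. dist p z = s \<and> (\<forall>w. (0 < k \<longrightarrow> dist w p + s \<le> pi / sqrt k) \<longrightarrow>
    (\<exists>\<beta>. 0 \<le> \<beta> \<and> \<beta> \<le> dist w q \<and> (0 < k \<longrightarrow> \<beta> \<le> pi / sqrt k) \<and>
      sn k (dist p q) * md k (dist w z)
            \<le> sn k (dist p q - s) * (md k (dist w p) - md k s)
              + sn k s * (md k \<beta> - md k (dist p q - s))))"
proof -
  obtain z where z: "dist p z = s" and I: "\<And>r. below_Dk k ((dist p q + dist q r + dist r p) / 2) \<Longrightarrow>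
      sn k (dist p q) * md k (dist r z)
            \<le> sn k (dist p q - s) * (md k (dist r p) - md k s)
              + sn k s * (md k (dist r q) - md k (dist p q - s))"
    using st L s unfolding stewart_def by metis
  have "\<exists>\<beta>. 0 \<le> \<beta> \<and> \<beta> \<le> dist w q \<and> (0 < k \<longrightarrow> \<beta> \<le> pi / sqrt k) \<and>
      sn k (dist p q) * md k (dist w z)
            \<le> sn k (dist p q - s) * (md k (dist w p) - md k s)
              + sn k s * (md k \<beta> - md k (dist p q - s))"
    if w: "0 < k \<longrightarrow> dist w p + s \<le> pi / sqrt k" for w
  proof (cases "below_Dk k ((dist p q + dist q w + dist w p) / 2)")
    case True
    have "dist w q \<le> (dist p q + dist q w + dist w p) / 2"
      using dist_triangle[of w q p] by (simp add: dist_commute)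
    then show ?thesis using I[OF True] below_DkD[OF True] by (intro exI[of _ "dist w q"]) auto
  next
    case False
    then have k0: "0 < k" and per: "2 * pi / sqrt k \<le> dist p q + dist q w + dist w p"
      by (auto simp: below_Dk_def mult.commute)
    define \<beta> where "\<beta> = 2 * pi / sqrt k - (dist p q + dist w p)"
    \<comment> \<open>With this \<beta> the right-hand side equals sn L md (d(w,p) + s) by
      \<open>stewart_collinear\<close>, and the triangle inequality through p suffices in place of
      the comparison.\<close>
    have "md k \<beta> = md k (dist p q + dist w p)" unfolding \<beta>_def by (rule md_reflect[OF k0])
    moreover have "dist w z \<le> dist w p + s" using dist_triangle[of w z p] z by simp
    then have "md k (dist w z) \<le> md k (dist w p + s)" using w k0 by (intro md_mono) auto
    then have "sn k (dist p q) * md k (dist w z) \<le> sn k (dist p q) * md k (dist w p + s)"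
      using L by (intro mult_left_mono sn_nonneg) (auto simp: below_Dk_def)
    moreover have "0 \<le> \<beta>" using w k0 L s by (auto simp: \<beta>_def below_Dk_def)
    moreover have "\<beta> \<le> dist w q" using per by (simp add: \<beta>_def dist_commute)
    moreover have "\<beta> \<le> pi / sqrt k"
      using dist_triangle[of w q p] per by (simp add: \<beta>_def dist_commute field_simps)
    ultimately show ?thesis unfolding stewart_collinear by (intro exI[of _ \<beta>]) auto
  qed
  with z show ?thesis by blast
qed

context small_compact
begin

text \<open>One step of the walk: z moves by \<delta> towards a farthest point x. The comparison in
  the triangle of z, x and w bounds \<open>md\<close> of d(w,x) from below, and
  \<open>square_diff_ge_md\<close> converts this into squares. For w = y, where d(y,x) <= R, the
  same bound limits the drift away from y to \<open>\<delta>\<^sup>2\<close> per step, measured by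
  \<open>md\<close>.\<close>

lemma circumradius_step:
  assumes y: "circumcenter X y" and R: "0 < R" and \<epsilon>: "0 < \<epsilon>" "below_Dk k (2 * (R + \<epsilon>))"
    and \<delta>: "0 < \<delta>" "\<delta> \<le> \<epsilon>" "\<delta> \<le> R" and z: "dist z y \<le> \<epsilon>"
  shows "\<exists>z' x L. x \<in> X \<and> R \<le> L \<and> L \<le> R + \<epsilon> \<and> dist z' y \<le> 2 * \<epsilon> \<and>
    md k (dist y z') \<le> md k (dist y z) + \<delta>\<^sup>2 \<and>
    (\<forall>w. dist w y \<le> 2 * R \<longrightarrow>
      2 * R / sn k R * (md k (R - \<delta>) - md k R + sn k L / sn k \<delta> * (md k (dist w z') - md k (dist w z)))
        \<le> (dist w x)\<^sup>2 - R\<^sup>2)"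
proof -
  have yR: "dist x y \<le> R" if "x \<in> X" for x using y that by (auto simp: circumcenter_def dist_commute)
  obtain x where x: "x \<in> X" "R \<le> dist x z" using ex_dist_ge_circumradius[OF cpt ne] by blast
  define L where "L = dist z x"
  have L: "R \<le> L" "L \<le> R + \<epsilon>"
    using x z yR[OF x(1)] dist_triangle[of z x y] by (auto simp: L_def dist_commute)
  have L2: "below_Dk k (2 * L)" using below_Dk_mono[OF \<epsilon>(2)] L by simp
  have Lb: "below_Dk k (dist z x)" using below_Dk_mono[OF L2] by (simp add: L_def)
  have "\<delta> \<le> dist z x" using \<delta> L by (simp add: L_def)
  from stewart_truncated[OF st k_nonneg Lb _ this]
  obtain z' where z': "dist z z' = \<delta>" and I: "\<And>w. (0 < k \<Longrightarrow> dist w z + \<delta> \<le> pi / sqrt k) \<Longrightarrow>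
    (\<exists>\<beta>. 0 \<le> \<beta> \<and> \<beta> \<le> dist w x \<and> (0 < k \<longrightarrow> \<beta> \<le> pi / sqrt k) \<and>
      sn k L * md k (dist w z') \<le> sn k (L - \<delta>) * (md k (dist w z) - md k \<delta>)
              + sn k \<delta> * (md k \<beta> - md k (L - \<delta>)))"
    unfolding L_def using \<delta> by auto
  have sd: "0 < sn k \<delta>" using \<delta> below_Dk_mono[OF below_2R] by (intro sn_pos) auto
  have sR: "0 < sn k R" using R below_Dk_mono[OF below_2R] by (intro sn_pos) auto
  have sL: "sn k R \<le> sn k L" using sn_mono[OF R_nonneg L(1) L2] .
  have sLd: "sn k (L - \<delta>) \<le> sn k L" using \<delta> L by (intro sn_mono[OF _ _ L2]) auto
  have sLd0: "0 \<le> sn k (L - \<delta>)"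
    using \<delta> L by (intro sn_nonneg below_DkD[OF Lb]) (auto simp: L_def)
  have mLd: "md k (R - \<delta>) \<le> md k (L - \<delta>)"
    using \<delta> L by (intro md_mono below_DkD[OF Lb]) (auto simp: L_def)
  have J: "\<exists>\<beta>. 0 \<le> \<beta> \<and> \<beta> \<le> dist w x \<and> (0 < k \<longrightarrow> \<beta> \<le> pi / sqrt k) \<and>
     md k (R - \<delta>) + sn k L / sn k \<delta> * (md k (dist w z') - md k (dist w z)) \<le> md k \<beta>"
    if w: "dist w y \<le> 2 * R" for w
  proof -
    \<comment> \<open>Here w must lie within 2R of y: this keeps it in the range of
      \<open>stewart_truncated\<close>.\<close>
    have "dist w z + \<delta> \<le> 2 * (R + \<epsilon>)" using w z \<delta> dist_triangle[of w z y] by (simp add: dist_commute)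
    from I[of w, OF below_DkD[OF \<epsilon>(2) this]] obtain \<beta>
      where b: "0 \<le> \<beta>" "\<beta> \<le> dist w x" "0 < k \<longrightarrow> \<beta> \<le> pi / sqrt k"
      and le: "sn k L * md k (dist w z') \<le> sn k (L - \<delta>) * (md k (dist w z) - md k \<delta>)
              + sn k \<delta> * (md k \<beta> - md k (L - \<delta>))" by blast
    have "sn k (L - \<delta>) * (md k (dist w z) - md k \<delta>) \<le> sn k L * md k (dist w z)"
      using mult_right_mono[OF sLd, of "md k (dist w z)"] mult_nonneg_nonneg[OF sLd0, of "md k \<delta>"]
      by (simp add: right_diff_distrib)
    moreover have "sn k \<delta> * (md k \<beta> - md k (L - \<delta>)) \<le> sn k \<delta> * (md k \<beta> - md k (R - \<delta>))"
      using sd mLd by (intro mult_left_mono) auto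
    ultimately have "sn k L * (md k (dist w z') - md k (dist w z)) \<le> sn k \<delta> * (md k \<beta> - md k (R - \<delta>))"
      using le by (simp add: right_diff_distrib)
    then have "sn k L / sn k \<delta> * (md k (dist w z') - md k (dist w z)) \<le> md k \<beta> - md k (R - \<delta>)"
      using sd by (simp add: pos_divide_le_eq mult.commute)
    with b show ?thesis by (intro exI[of _ \<beta>]) auto
  qed
  have "2 * R / sn k R * (md k (R - \<delta>) - md k R + sn k L / sn k \<delta> * (md k (dist w z') - md k (dist w z)))
        \<le> (dist w x)\<^sup>2 - R\<^sup>2" if w: "dist w y \<le> 2 * R" for w
  proof -
    obtain \<beta> where b: "0 \<le> \<beta>" "\<beta> \<le> dist w x" "0 < k \<longrightarrow> \<beta> \<le> pi / sqrt k"
      "md k (R - \<delta>) + sn k L / sn k \<delta> * (md k (dist w z') - md k (dist w z)) \<le> md k \<beta>"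
      using J[OF w] by blast
    have "2 * R / sn k R * (md k (R - \<delta>) - md k R + sn k L / sn k \<delta> * (md k (dist w z') - md k (dist w z)))
       \<le> 2 * R / sn k R * (md k \<beta> - md k R)"
      using b(4) R sR by (intro mult_left_mono) auto
    also have "\<dots> \<le> \<beta>\<^sup>2 - R\<^sup>2" using b R below_Dk_mono[OF below_2R]
      by (intro square_diff_ge_md k_nonneg) auto
    also have "\<dots> \<le> (dist w x)\<^sup>2 - R\<^sup>2" using b by (simp add: power_mono)
    finally show ?thesis .
  qed
  moreover have "md k (dist y z') \<le> md k (dist y z) + \<delta>\<^sup>2"
  proof -
    obtain \<beta> where b: "0 \<le> \<beta>" "\<beta> \<le> dist y x"
      "md k (R - \<delta>) + sn k L / sn k \<delta> * (md k (dist y z') - md k (dist y z)) \<le> md k \<beta>"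
      using J[of y] R by auto
    have "md k \<beta> \<le> md k R"
      using b yR[OF x(1)] R by (intro md_mono below_DkD[OF below_2R]) (auto simp: dist_commute)
    then have "sn k L / sn k \<delta> * (md k (dist y z') - md k (dist y z)) \<le> \<delta> * sn k R"
      using b(3) md_diff_le[OF k_nonneg _ \<delta>(3) below_2R] \<delta> by simp
    then have "sn k L * (md k (dist y z') - md k (dist y z)) \<le> sn k \<delta> * \<delta> * sn k R"
      using sd by (simp add: pos_divide_le_eq mult_ac)
    also have "\<dots> \<le> \<delta> * \<delta> * sn k L"
      using sn_le_self[OF k_nonneg, of \<delta>] \<delta> sL sR sd by (intro mult_mono) auto
    finally have "sn k L * (md k (dist y z') - md k (dist y z)) \<le> sn k L * \<delta>\<^sup>2"
      by (simp add: power2_eq_square mult_ac)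
    then show ?thesis using sL sR by simp
  qed
  moreover have "dist z' y \<le> 2 * \<epsilon>" using dist_triangle[of z' y z] z z' \<delta> by (simp add: dist_commute)
  ultimately show ?thesis using x L by blast
qed

text \<open>Multiplying the inequality of the previous lemma by \<open>1 / sn k L\<close> makes the sum over the steps
  telescope, hence the weights. A step length \<open>\<delta>\<close> with \<open>N \<delta>\<^sup>2 = \<theta>\<close> constant keeps all points within
  distance \<open>\<epsilon>\<close> of \<open>y\<close>, while \<open>N \<delta>\<close> is unbounded.\<close>
lemma ex_weighted_points:
  assumes y: "circumcenter X y" and R: "0 < R" and e: "0 < e"
  shows "\<exists>(N::nat) x p. (\<forall>i<N. x i \<in> X \<and> 0 \<le> p i) \<and> (\<Sum>i<N. p i) = 1 \<and>
    (\<forall>w. R\<^sup>2 - e \<le> (\<Sum>i<N. p i * (dist (x i) w)\<^sup>2))"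
proof -
  have yR: "dist x y \<le> R" if "x \<in> X" for x using y that by (auto simp: circumcenter_def dist_commute)
  obtain \<rho> where r0: "R < \<rho>" "below_Dk k (2 * \<rho>)" using ex_below_2_gt_R by blast
  define \<epsilon> where "\<epsilon> = \<rho> - R"
  have \<epsilon>: "0 < \<epsilon>" "below_Dk k (2 * (R + \<epsilon>))" using r0 by (auto simp: \<epsilon>_def)
  define K where "K = 2 * R / sn k R"
  have sR: "0 < sn k R" using R below_Dk_mono[OF below_2R] by (intro sn_pos) auto
  have K: "0 < K" using R sR by (simp add: K_def)
  have s\<epsilon>: "0 < sn k \<epsilon>" using \<epsilon> R below_Dk_mono[OF \<epsilon>(2)] by (intro sn_pos) auto
  \<comment> \<open>The budget for the drift: N steps raise \<open>md\<close> of the distance to y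
    by at most N \<delta>^2 = md \<epsilon>.\<close>
  define \<theta> where "\<theta> = md k \<epsilon>"
  have "md k 0 < md k \<epsilon>" using \<epsilon> R by (intro md_strict_mono below_DkD[OF \<epsilon>(2)]) auto
  then have \<theta>: "0 < \<theta>" by (simp add: \<theta>_def)
  define S where "S = sn k (R + \<epsilon>)"
  have S: "0 < S" using \<epsilon> R below_Dk_mono[OF \<epsilon>(2)] unfolding S_def by (intro sn_pos) auto
  \<comment> \<open>The total error at step length sqrt (\<theta> / N): \<delta> sn R is the loss
    per step, and the second summand is the initial term of the telescoping sum, at most md (2R) /
    sn \<delta>, divided by the total weight, which is at least N / S.\<close>
  have "(\<lambda>N::nat. K * (sqrt (\<theta> / N) * sn k R + md k (2 * R) * S * \<epsilon> / (sn k \<epsilon> * (N * sqrt (\<theta> / N))))) \<longlonglongrightarrow> 0"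
    using \<theta> s\<epsilon> by real_asymp
  then have ev1: "\<forall>\<^sub>F N::nat in sequentially.
     K * (sqrt (\<theta> / N) * sn k R + md k (2 * R) * S * \<epsilon> / (sn k \<epsilon> * (N * sqrt (\<theta> / N)))) < e"
    using e by (rule order_tendstoD)
  have "(\<lambda>N::nat. sqrt (\<theta> / N)) \<longlonglongrightarrow> 0" using \<theta> by real_asymp
  then have ev2: "\<forall>\<^sub>F N::nat in sequentially. sqrt (\<theta> / N) < min \<epsilon> R"
    using \<epsilon> R by (intro order_tendstoD) auto
  have "\<forall>\<^sub>F N::nat in sequentially. 0 < N" by (rule eventually_gt_at_top)
  with ev1 ev2 have "\<forall>\<^sub>F N::nat in sequentially. K * (sqrt (\<theta> / N) * sn k R + md k (2 * R) * S * \<epsilon> / (sn k \<epsilon> * (N * sqrt (\<theta> / N)))) < e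
     \<and> sqrt (\<theta> / N) < min \<epsilon> R \<and> 0 < N" by eventually_elim auto
  then obtain N :: nat where N0: "0 < N" and Nmin: "sqrt (\<theta> / N) < min \<epsilon> R" and
    Nerr: "K * (sqrt (\<theta> / N) * sn k R + md k (2 * R) * S * \<epsilon> / (sn k \<epsilon> * (N * sqrt (\<theta> / N)))) < e"
    by (auto simp: eventually_sequentially)
  define \<delta> where "\<delta> = sqrt (\<theta> / N)"
  have \<delta>: "0 < \<delta>" "\<delta> \<le> \<epsilon>" "\<delta> \<le> R" using \<theta> N0 Nmin by (auto simp: \<delta>_def)
  have N\<delta>: "real N * \<delta>\<^sup>2 = \<theta>" using \<theta> N0 by (simp add: \<delta>_def)
  \<comment> \<open>Dependent choice yields an infinite sequence; the guard \<open>n \<le> N\<close>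
    makes the invariant void once the budget is spent.\<close>
  define P where "P = (\<lambda>n z. (n = 0 \<longrightarrow> z = y) \<and> (n \<le> N \<longrightarrow> dist z y \<le> \<epsilon> \<and> md k (dist y z) \<le> real n * \<delta>\<^sup>2))"
  define Q where "Q = (\<lambda>z z' x L. x \<in> X \<and> R \<le> L \<and> L \<le> R + \<epsilon> \<and> (\<forall>w. dist w y \<le> 2 * R \<longrightarrow>
      K * (md k (R - \<delta>) - md k R + sn k L / sn k \<delta> * (md k (dist w z') - md k (dist w z)))
        \<le> (dist w x)\<^sup>2 - R\<^sup>2))"
  have "\<exists>f. \<forall>n. P n (f n) \<and> (n < N \<longrightarrow> (\<exists>x L. Q (f n) (f (Suc n)) x L))"
  proof (rule dependent_nat_choice)
    show "\<exists>z. P 0 z" using \<epsilon> by (intro exI[of _ y]) (auto simp: P_def)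
    fix z n assume Pz: "P n z"
    show "\<exists>z'. P (Suc n) z' \<and> (n < N \<longrightarrow> (\<exists>x L. Q z z' x L))"
    proof (cases "n < N")
      case True
      then have z: "dist z y \<le> \<epsilon>" "md k (dist y z) \<le> real n * \<delta>\<^sup>2" using Pz by (auto simp: P_def)
      obtain z' x L where z': "x \<in> X" "R \<le> L" "L \<le> R + \<epsilon>" "dist z' y \<le> 2 * \<epsilon>"
         "md k (dist y z') \<le> md k (dist y z) + \<delta>\<^sup>2"
         "\<forall>w. dist w y \<le> 2 * R \<longrightarrow>
      K * (md k (R - \<delta>) - md k R + sn k L / sn k \<delta> * (md k (dist w z') - md k (dist w z)))
        \<le> (dist w x)\<^sup>2 - R\<^sup>2"
        using circumradius_step[OF y R \<epsilon> \<delta> z(1)] unfolding K_def by blast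
      have le: "md k (dist y z') \<le> real (Suc n) * \<delta>\<^sup>2" using z'(5) z(2) by (simp add: algebra_simps)
      also have "\<dots> \<le> real N * \<delta>\<^sup>2" using True by (intro mult_right_mono) auto
      finally have "md k (dist y z') \<le> md k \<epsilon>" using N\<delta> by (simp add: \<theta>_def)
      \<comment> \<open>The a priori bound 2 \<epsilon> places d(y,z') where \<open>md\<close> is
        strictly increasing, so the bound on \<open>md\<close> improves it to \<epsilon>.\<close>
      moreover have "md k \<epsilon> < md k (dist y z')" if "\<epsilon> < dist y z'"
        using that \<epsilon> z'(4) R by (intro md_strict_mono below_DkD[OF \<epsilon>(2)]) (auto simp: dist_commute)
      ultimately have "dist z' y \<le> \<epsilon>" by (metis dist_commute linorder_not_less)
      then show ?thesis using z' le by (intro exI[of _ z']) (auto simp: P_def Q_def)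
    next
      case False
      then show ?thesis by (auto simp: P_def)
    qed
  qed
  then obtain z where z: "\<And>n. P n (z n)" and "\<forall>n. \<exists>x L. n < N \<longrightarrow> Q (z n) (z (Suc n)) x L" by blast
  then obtain x L where Q: "\<And>n. n < N \<Longrightarrow> Q (z n) (z (Suc n)) (x n) (L n)" by metis
  have z0: "z 0 = y" using z[of 0] by (simp add: P_def)
  have sL: "0 < sn k (L i)" "sn k (L i) \<le> S" if "i < N" for i
  proof -
    have "R \<le> L i" "L i \<le> R + \<epsilon>" using Q[OF that] by (auto simp: Q_def)
    then show "0 < sn k (L i)" "sn k (L i) \<le> S" unfolding S_def
      using R by (auto intro!: sn_pos sn_mono \<epsilon>(2) below_Dk_mono[OF \<epsilon>(2)])
  qed
  define W where "W = (\<Sum>i<N. 1 / sn k (L i))"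
  have "real N / S = (\<Sum>i<N. 1 / S)" by simp
  also have "\<dots> \<le> W" unfolding W_def using sL S by (intro sum_mono divide_left_mono) (auto intro: mult_pos_pos)
  finally have WN: "real N / S \<le> W" .
  moreover have "0 < real N / S" using N0 S by simp
  ultimately have W: "0 < W" by linarith
  define p where "p = (\<lambda>i. 1 / sn k (L i) / W)"
  have "(\<Sum>i<N. p i) = W / W" unfolding p_def sum_divide_distrib[symmetric] W_def[symmetric] ..
  then have sp: "(\<Sum>i<N. p i) = 1" using W by simp
  have p0: "0 \<le> p i" if "i < N" for i using sL[OF that] W by (simp add: p_def)
  have xX: "x i \<in> X" if "i < N" for i using Q[OF that] by (simp add: Q_def)
  have sd: "0 < sn k \<delta>" using \<delta> below_Dk_mono[OF below_2R] by (intro sn_pos) auto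
  have "R\<^sup>2 - e \<le> (\<Sum>i<N. p i * (dist (x i) w)\<^sup>2)" for w
  proof (cases "dist w y \<le> 2 * R")
    case False
    \<comment> \<open>Far from y the claim is immediate, since X lies in the ball of radius R about
      y.\<close>
    have "R\<^sup>2 \<le> (dist (x i) w)\<^sup>2" if "i < N" for i
      using yR[OF xX[OF that]] dist_triangle2[of w y "x i"] False R
      by (intro power_mono) (auto simp: dist_commute)
    then have "(\<Sum>i<N. p i * R\<^sup>2) \<le> (\<Sum>i<N. p i * (dist (x i) w)\<^sup>2)"
      using p0 by (intro sum_mono mult_left_mono) auto
    then show ?thesis using e by (simp add: sp flip: sum_distrib_right)
  next
    case True
    have tel: "(\<Sum>i<N. md k (dist w (z (Suc i))) - md k (dist w (z i))) = md k (dist w (z N)) - md k (dist w y)"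
      using sum_lessThan_telescope[of "\<lambda>i. md k (dist w (z i))" N] z0 by simp
    have "K * (W * (md k (R - \<delta>) - md k R) + (md k (dist w (z N)) - md k (dist w y)) / sn k \<delta>)
      = (\<Sum>i<N. 1 / sn k (L i) * (K * (md k (R - \<delta>) - md k R)) + K / sn k \<delta> * (md k (dist w (z (Suc i))) - md k (dist w (z i))))"
      unfolding sum.distrib sum_distrib_left[symmetric] sum_distrib_right[symmetric] W_def[symmetric] tel
      by (simp add: algebra_simps diff_divide_distrib)
    also have "\<dots> \<le> (\<Sum>i<N. 1 / sn k (L i) * ((dist w (x i))\<^sup>2 - R\<^sup>2))"
    proof (rule sum_mono)
      fix i assume "i \<in> {..<N}"
      then have i: "i < N" by simp
      have "1 / sn k (L i) * (K * (md k (R - \<delta>) - md k R)) + K / sn k \<delta> * (md k (dist w (z (Suc i))) - md k (dist w (z i)))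
         = 1 / sn k (L i) * (K * (md k (R - \<delta>) - md k R + sn k (L i) / sn k \<delta> * (md k (dist w (z (Suc i))) - md k (dist w (z i)))))"
        using sL[OF i] by (simp add: distrib_left)
      also have "\<dots> \<le> 1 / sn k (L i) * ((dist w (x i))\<^sup>2 - R\<^sup>2)"
        using Q[OF i] True sL[OF i] unfolding Q_def by (intro mult_left_mono) auto
      finally show "1 / sn k (L i) * (K * (md k (R - \<delta>) - md k R)) + K / sn k \<delta> * (md k (dist w (z (Suc i))) - md k (dist w (z i))) \<le> \<dots>" .
    qed
    also have "\<dots> = W * (\<Sum>i<N. p i * ((dist w (x i))\<^sup>2 - R\<^sup>2))"
      using W by (simp add: p_def sum_distrib_left)
    also have "(\<Sum>i<N. p i * ((dist w (x i))\<^sup>2 - R\<^sup>2)) = (\<Sum>i<N. p i * (dist (x i) w)\<^sup>2) - R\<^sup>2"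
      using sp by (simp add: right_diff_distrib sum_subtractf dist_commute flip: sum_distrib_right)
    finally have A: "K * (W * (md k (R - \<delta>) - md k R) + (md k (dist w (z N)) - md k (dist w y)) / sn k \<delta>)
       \<le> W * ((\<Sum>i<N. p i * (dist (x i) w)\<^sup>2) - R\<^sup>2)" .
    have 1: "md k R - md k (R - \<delta>) \<le> \<delta> * sn k R"
      using md_diff_le[OF k_nonneg _ \<delta>(3) below_2R] \<delta> by simp
    have 2: "md k (dist w y) / sn k \<delta> \<le> W * (md k (2 * R) * S * \<epsilon> / (sn k \<epsilon> * (N * \<delta>)))"
    proof -
      have "md k (dist w y) \<le> md k (2 * R)"
        using True by (intro md_mono below_DkD[OF below_2R]) auto
      moreover have "\<delta> * sn k \<epsilon> \<le> \<epsilon> * sn k \<delta>"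
        using \<delta> \<epsilon> R by (intro sn_ratio_antimono k_nonneg below_DkD[OF \<epsilon>(2)]) auto
      then have "1 / sn k \<delta> \<le> \<epsilon> / (\<delta> * sn k \<epsilon>)" using sd s\<epsilon> \<delta> by (simp add: field_simps)
      ultimately have "md k (dist w y) * (1 / sn k \<delta>) \<le> md k (2 * R) * (\<epsilon> / (\<delta> * sn k \<epsilon>))"
        using sd by (intro mult_mono) auto
      also have "\<dots> \<le> (W * S / N) * (md k (2 * R) * (\<epsilon> / (\<delta> * sn k \<epsilon>)))"
      proof -
        have "1 \<le> W * S / N" using WN S N0 by (simp add: field_simps)
        moreover have "0 \<le> md k (2 * R) * (\<epsilon> / (\<delta> * sn k \<epsilon>))" using \<epsilon> \<delta> s\<epsilon> by simp
        ultimately show ?thesis using mult_right_mono by fastforce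
      qed
      finally show ?thesis by (simp add: mult_ac)
    qed
    have "W * (- (\<delta> * sn k R + md k (2 * R) * S * \<epsilon> / (sn k \<epsilon> * (N * \<delta>))))
        \<le> W * (md k (R - \<delta>) - md k R) + (md k (dist w (z N)) - md k (dist w y)) / sn k \<delta>"
    proof -
      have "W * (- (\<delta> * sn k R)) \<le> W * (md k (R - \<delta>) - md k R)" using 1 W by (intro mult_left_mono) auto
      moreover have "0 \<le> md k (dist w (z N)) / sn k \<delta>" using sd by simp
      ultimately show ?thesis using 2
        unfolding diff_divide_distrib minus_add_distrib distrib_left mult_minus_right by linarith
    qed
    then have "K * (W * (- (\<delta> * sn k R + md k (2 * R) * S * \<epsilon> / (sn k \<epsilon> * (N * \<delta>))))) \<le>
        K * (W * (md k (R - \<delta>) - md k R) + (md k (dist w (z N)) - md k (dist w y)) / sn k \<delta>)"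
      using K by (intro mult_left_mono) auto
    also note A
    finally have "W * (- (K * (\<delta> * sn k R + md k (2 * R) * S * \<epsilon> / (sn k \<epsilon> * (N * \<delta>))))) \<le> W * ((\<Sum>i<N. p i * (dist (x i) w)\<^sup>2) - R\<^sup>2)"
      by (simp only: mult.left_commute[of W K] mult_minus_right)
    then have "- (K * (\<delta> * sn k R + md k (2 * R) * S * \<epsilon> / (sn k \<epsilon> * (N * \<delta>)))) \<le> (\<Sum>i<N. p i * (dist (x i) w)\<^sup>2) - R\<^sup>2"
      using W by (simp only: mult_le_cancel_left_pos)
    then show ?thesis using Nerr unfolding \<delta>_def by simp
  qed
  then show ?thesis using sp p0 xX by (intro exI[of _ N] exI[of _ x] exI[of _ p]) auto
qed

end

text \<open>The pmf lives on the indices and is pushed forward, so points may repeat: the walk may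
  choose the same target many times.\<close>

lemma ex_discrete_Prob_on:
  fixes X :: "'a::metric_space set" and x :: "nat \<Rightarrow> 'a"
  assumes X: "closed X" and x: "\<And>i. i < N \<Longrightarrow> x i \<in> X" and p: "\<And>i. i < N \<Longrightarrow> 0 \<le> p i" "(\<Sum>i<N. p i) = 1"
  shows "\<exists>\<nu>\<in>Prob_on X. \<forall>f\<in>borel_measurable borel. (\<integral>x. f x \<partial>\<nu>) = (\<Sum>i<N. p i * (f (x i) :: real))"
proof -
  define f where "f = (\<lambda>i. if i < N then p i else 0)"
  define P where "P = embed_pmf f"
  have f0: "0 \<le> f i" for i using p by (simp add: f_def)
  have fN: "i < N" if "f i \<noteq> 0" for i using that by (simp add: f_def split: if_split_asm)
  have "(\<integral>\<^sup>+ i. ennreal (f i) \<partial>count_space UNIV) = (\<Sum>i<N. ennreal (f i))"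
    by (intro nn_integral_count_space') (auto intro: fN)
  also have "\<dots> = ennreal (\<Sum>i<N. f i)" using f0 by (simp add: sum_ennreal)
  also have "(\<Sum>i<N. f i) = 1" using p by (simp add: f_def)
  finally have P: "pmf P i = f i" for i unfolding P_def using f0 by (intro pmf_embed_pmf) auto
  have sP: "set_pmf P \<subseteq> {..<N}" by (auto simp: set_pmf_iff P intro: fN)
  define \<nu> where "\<nu> = distr (measure_pmf P) borel x"
  have "emeasure \<nu> X = emeasure (measure_pmf P) (x -` X)"
    unfolding \<nu>_def using X by (subst emeasure_distr) auto
  also have "\<dots> = 1" using sP x
    by (intro measure_pmf.emeasure_eq_1_AE) (auto simp: AE_measure_pmf_iff)
  finally have "\<nu> \<in> Prob_on X"
    unfolding Prob_on_def \<nu>_def by (auto intro!: measure_pmf.prob_space_distr)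
  moreover have "(\<integral>x. g x \<partial>\<nu>) = (\<Sum>i<N. p i * g (x i))" if "g \<in> borel_measurable borel" for g :: "'a \<Rightarrow> real"
  proof -
    have "(\<integral>x. g x \<partial>\<nu>) = (\<integral>i. g (x i) \<partial>measure_pmf P)"
      unfolding \<nu>_def using that by (intro integral_distr) auto
    also have "\<dots> = (\<Sum>i<N. g (x i) * pmf P i)"
      using sP by (intro integral_measure_pmf_real) auto
    finally show ?thesis by (simp add: P f_def mult.commute)
  qed
  ultimately show ?thesis by blast
qed

section \<open>Moving the circumcenter\<close>

text \<open>The bound on \<open>c\<close> is the cosine of the angle at the apex of the model triangle with sides
  \<open>r, r, D\<close>.\<close>
lemma ex_closer_point:
  fixes X :: "'a::metric_space set"
  assumes st: "stewart k TYPE('a)" and r: "0 < r" "below_Dk k (2 * r)"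
    and y: "\<And>x. x \<in> X \<Longrightarrow> dist x y \<le> r" and x0: "dist x0 y = r"
    and D: "\<And>x. x \<in> X \<Longrightarrow> dist x x0 \<le> D" "D \<le> 2 * r"
    and c: "c < 1 - md k D / (sn k r)\<^sup>2"
  shows "\<exists>t0>0. \<forall>t. 0 < t \<and> t < t0 \<longrightarrow> (\<exists>z. dist x0 z = r - t \<and> (\<forall>x\<in>X. dist x z \<le> r - c * t))"
proof -
  have sr: "0 < sn k r" using r below_Dk_mono[OF r(2)] by (intro sn_pos) auto
  \<comment> \<open>The comparison bound for all x in X at once, with d(x,y) and d(x,x0) replaced by
    their upper bounds r and D. \<open>G\<close> vanishes at 0, and the hypothesis on
    \<open>c\<close> says exactly that its derivative there is positive.\<close>
  define V where "V = (\<lambda>t. sn k (r - t) * (md k r - md k t) + sn k t * (md k D - md k (r - t)))"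
  define G where "G = (\<lambda>t. sn k r * md k (r - c * t) - V t)"
  have "(G has_real_derivative (sn k r)\<^sup>2 * (1 - md k D / (sn k r)\<^sup>2 - c)) (at 0)"
  proof -
    have "(G has_real_derivative - c * (sn k r)\<^sup>2 - (- cs k r * md k r + (md k D - md k r))) (at 0)"
      unfolding G_def V_def
      by (auto intro!: derivative_eq_intros DERIV_chain2[OF has_derivative_sn] DERIV_chain2[OF has_derivative_md]
          simp: power2_eq_square)
    moreover have "- c * (sn k r)\<^sup>2 - (- cs k r * md k r + (md k D - md k r)) = (1 - c) * (sn k r)\<^sup>2 - md k D"
      using sn_md[of k r] by (simp add: algebra_simps)
    moreover have "(1 - c) * (sn k r)\<^sup>2 - md k D = (sn k r)\<^sup>2 * (1 - md k D / (sn k r)\<^sup>2 - c)"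
      using sr by (simp add: field_simps)
    ultimately show ?thesis by simp
  qed
  moreover have "0 < (sn k r)\<^sup>2 * (1 - md k D / (sn k r)\<^sup>2 - c)" using sr c by simp
  ultimately obtain d where d: "0 < d" "\<And>h. 0 < h \<Longrightarrow> h < d \<Longrightarrow> G 0 < G h"
    using DERIV_pos_inc_right by (metis add_0)
  \<comment> \<open>The last bound keeps r - c t nonnegative for either sign of
    \<open>c\<close>.\<close>
  define t0 where "t0 = min d (min r (r / (1 + \<bar>c\<bar>)))"
  have "\<exists>z. dist x0 z = r - t \<and> (\<forall>x\<in>X. dist x z \<le> r - c * t)" if t: "0 < t" "t < t0" for t
  proof -
    have t': "t < d" "t < r" "t < r / (1 + \<bar>c\<bar>)" using t by (auto simp: t0_def)
    have "c * t \<le> \<bar>c\<bar> * t" using t by (simp add: mult_right_mono)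
    also have "\<dots> \<le> (1 + \<bar>c\<bar>) * t" using t by (simp add: distrib_right)
    also have "\<dots> \<le> r" using t'(3) by (simp add: field_simps)
    finally have rc: "0 \<le> r - c * t" by simp
    have GV: "V t < sn k r * md k (r - c * t)" using d(2)[OF t(1) t'(1)] by (simp add: G_def V_def)
    have yx0: "dist y x0 = r" using x0 by (simp add: dist_commute)
    have "below_Dk k (dist y x0)" using below_Dk_mono[OF r(2)] r yx0 by simp
    with st t t' yx0 obtain z where z: "dist y z = t" "dist z x0 = r - t"
      and I: "\<And>x. below_Dk k ((r + dist x0 x + dist x y) / 2) \<Longrightarrow>
          sn k r * md k (dist x z) \<le> sn k (r - t) * (md k (dist x y) - md k t)
              + sn k t * (md k (dist x x0) - md k (r - t))"
      unfolding stewart_def by (metis less_eq_real_def)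
    have "dist x z \<le> r - c * t" if x: "x \<in> X" for x
    proof -
      have tri: "dist x x0 \<le> dist x y + r" using dist_triangle[of x x0 y] yx0 by simp
      then have "(r + dist x0 x + dist x y) / 2 \<le> 2 * r" using y[OF x] by (simp add: dist_commute)
      from I[OF below_Dk_mono[OF r(2) this]]
      have "sn k r * md k (dist x z) \<le> sn k (r - t) * (md k (dist x y) - md k t)
              + sn k t * (md k (dist x x0) - md k (r - t))" .
      also have "\<dots> \<le> V t"
      proof -
        have "md k (dist x y) \<le> md k r" using y[OF x] r by (intro md_mono below_DkD[OF r(2)]) auto
        moreover have "md k (dist x x0) \<le> md k D" using D x by (intro md_mono below_DkD[OF r(2)]) auto
        moreover have "0 \<le> sn k (r - t)" "0 \<le> sn k t"
          using t t' by (auto intro!: sn_nonneg below_DkD[OF r(2)])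
        ultimately show ?thesis unfolding V_def by (intro add_mono mult_left_mono) auto
      qed
      finally have "md k (dist x z) < md k (r - c * t)" using GV sr by (smt (verit) mult_less_cancel_left_pos)
      moreover have "md k (r - c * t) \<le> md k (dist x z)" if "r - c * t \<le> dist x z"
      proof -
        have "dist x z \<le> 2 * r" using dist_triangle[of x z y] z y[OF x] t' by (simp add: dist_commute)
        then show ?thesis using rc that by (intro md_mono below_DkD[OF r(2)]) auto
      qed
      ultimately show ?thesis by linarith
    qed
    with z show ?thesis by (auto simp: dist_commute)
  qed
  moreover have "0 < t0" using d r by (auto simp: t0_def intro!: divide_pos_pos)
  ultimately show ?thesis by blast
qed

text \<open>Since md D = 2 (sn (D / 2))^2, the hypothesis says c sn r <= sn (D / 2), and
  \<open>S_coef\<close> is twice the inverse of \<open>sn\<close> at c sn r.\<close>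

lemma S_coef_le:
  assumes r: "0 \<le> r" "below_Dk k (2 * r)" and D: "0 \<le> D" "D \<le> 2 * r" and c: "0 \<le> c"
    and le: "c\<^sup>2 * (2 * (sn k r)\<^sup>2) \<le> md k D"
  shows "S_coef c r k \<le> D"
proof -
  have s0: "0 \<le> sn k r" "0 \<le> sn k (D / 2)" using r D by (auto intro!: sn_nonneg below_DkD[OF r(2)])
  have "(c * sn k r)\<^sup>2 \<le> (sn k (D / 2))\<^sup>2" using le by (simp add: md_def power_mult_distrib)
  then have 1: "c * sn k r \<le> sn k (D / 2)" using s0 by (rule_tac power2_le_imp_le)
  show ?thesis
  proof (cases k "0::real" rule: linorder_cases)
    case less
    then have "c * sinh (sqrt (- k) * r) \<le> sinh (sqrt (- k) * (D / 2))"
      using 1 by (simp add: sn_def divide_le_cancel)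
    then have "arsinh (c * sinh (sqrt (- k) * r)) \<le> arsinh (sinh (sqrt (- k) * (D / 2)))"
      by (simp flip: not_less)
    then show ?thesis using less by (simp add: S_coef_def arsinh_sinh_real field_simps)
  next
    case equal
    then show ?thesis using 1 by (simp add: S_coef_def sn_def field_simps)
  next
    case greater
    then have "c * sin (sqrt k * r) \<le> sin (sqrt k * (D / 2))"
      using 1 by (simp add: sn_def divide_le_cancel)
    moreover have "0 \<le> sin (sqrt k * r)" using s0(1) greater by (simp add: sn_def zero_le_divide_iff)
    then have "0 \<le> c * sin (sqrt k * r)" using c by simp
    ultimately have le_arcsin: "arcsin (c * sin (sqrt k * r)) \<le> arcsin (sin (sqrt k * (D / 2)))"
      by (intro arcsin_le_arcsin) auto
    have "sqrt k * D \<le> pi"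
      using below_DkD[OF r(2) D(2) greater] greater by (simp add: pos_le_divide_eq mult.commute)
    moreover have "0 \<le> sqrt k * D" using D greater by simp
    ultimately have "arcsin (sin (sqrt k * (D / 2))) = sqrt k * (D / 2)"
      using pi_ge_zero by (intro arcsin_sin) linarith+
    then show ?thesis using le_arcsin greater by (simp add: S_coef_def field_simps)
  qed
qed

section \<open>Finitely supported measures and their variance\<close>

lemma finite_support_integral:
  fixes \<mu> :: "'a::metric_space measure" and g :: "'a \<Rightarrow> real"
  assumes "prob_space \<mu>" and sets: "sets \<mu> = sets borel" and F: "finite F" "emeasure \<mu> F = 1"
    and g: "g \<in> borel_measurable borel"
  shows "(\<integral>x. g x \<partial>\<mu>) = (\<Sum>x\<in>F. measure \<mu> {x} * g x)"
proof -
  interpret prob_space \<mu> by fact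
  have Fs: "F \<in> sets \<mu>" using F sets by (simp add: finite_imp_closed borel_closed)
  have sing: "{a} \<in> sets \<mu>" for a using sets by (simp add: borel_closed)
  have "measure \<mu> F = 1" using F by (simp add: measure_def)
  then have "AE x in \<mu>. x \<in> F" using AE_in_set_eq_1[OF Fs] by simp
  then have "AE x in \<mu>. g x = (\<Sum>a\<in>F. indicator {a} x * g a)"
  proof eventually_elim
    case (elim x)
    have "(\<Sum>a\<in>F. indicator {a} x * g a) = (\<Sum>a\<in>F. if a = x then g a else 0)"
      by (intro sum.cong) (auto simp: indicator_def)
    then show ?case using elim F by simp
  qed
  moreover have "g \<in> borel_measurable \<mu>" using g measurable_cong_sets[OF sets refl] by blast
  moreover have "(\<lambda>x. \<Sum>a\<in>F. indicator {a} x * g a) \<in> borel_measurable \<mu>"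
    using sing by (intro borel_measurable_sum borel_measurable_times borel_measurable_indicator) auto
  ultimately have "(\<integral>x. g x \<partial>\<mu>) = (\<integral>x. (\<Sum>a\<in>F. indicator {a} x * g a) \<partial>\<mu>)"
    by (intro integral_cong_AE)
  also have "\<dots> = (\<Sum>a\<in>F. \<integral>x. indicator {a} x * g a \<partial>\<mu>)"
    using sing by (intro Bochner_Integration.integral_sum) (auto simp: emeasure_eq_measure)
  also have "\<dots> = (\<Sum>a\<in>F. measure \<mu> {a} * g a)"
    using sing by (intro sum.cong) (auto simp: emeasure_eq_measure sets.Int_space_eq2)
  finally show ?thesis .
qed

lemma Var_le:
  fixes \<mu> :: "'a::metric_space measure"
  shows "Var \<mu> \<le> (\<integral>x. (dist x z)\<^sup>2 \<partial>\<mu>)"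
  unfolding Var_def by (rule cINF_lower) (auto intro!: bdd_belowI2[of _ 0])

lemma borel_measurable_dist_square:
  "(\<lambda>x::'a::metric_space. (dist x z)\<^sup>2) \<in> borel_measurable borel"
  by (intro borel_measurable_continuous_onI continuous_intros)

lemma (in small_compact) circumradius_le_maximal_Var:
  assumes R: "0 < R" and \<mu>: "variance_maximizer X \<mu>"
  shows "R\<^sup>2 \<le> Var \<mu>"
proof (rule field_le_epsilon)
  fix e :: real assume e: "0 < e"
  obtain y where y: "circumcenter X y" using ex_circumcenter by blast
  from ex_weighted_points[OF y R e] obtain N x p where
    x: "\<And>i. i < N \<Longrightarrow> x i \<in> X" and p: "\<And>i. i < N \<Longrightarrow> 0 \<le> p i" "(\<Sum>i<N. p i) = 1"
    and w: "\<And>w. R\<^sup>2 - e \<le> (\<Sum>i<(N::nat). p i * (dist (x i) w)\<^sup>2)" by blast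
  obtain \<nu> where \<nu>: "\<nu> \<in> Prob_on X" and
    I: "\<forall>f\<in>borel_measurable borel. (\<integral>x. f x \<partial>\<nu>) = (\<Sum>i<N. p i * (f (x i) :: real))"
    using ex_discrete_Prob_on[OF compact_imp_closed[OF cpt], of N x p] x p by blast
  have "R\<^sup>2 - e \<le> Var \<nu>"
    unfolding Var_def
  proof (rule cINF_greatest)
    fix z
    show "R\<^sup>2 - e \<le> (\<integral>x. (dist x z)\<^sup>2 \<partial>\<nu>)" using w[of z] I borel_measurable_dist_square[of z] by simp
  qed simp
  also have "\<dots> \<le> Var \<mu>" using \<mu> \<nu> by (auto simp: variance_maximizer_def)
  finally show "R\<^sup>2 \<le> Var \<mu> + e" by simp
qed

text \<open>The right-hand side expands to r^2 - 2 r A t + B t^2 with A = p + (1 - p) c, so A > 0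
  would push it below r^2 for small t.\<close>

lemma weighted_squares_lower_bound:
  fixes a b c p r t0 :: real
  assumes r: "0 < r" and p: "0 \<le> p" "p \<le> 1" and t0: "0 < t0"
    and le: "\<And>t. 0 < t \<Longrightarrow> t < t0 \<Longrightarrow> r\<^sup>2 \<le> p * (r - t)\<^sup>2 + (1 - p) * (r - c * t)\<^sup>2"
  shows "p + (1 - p) * c \<le> 0"
proof (rule ccontr)
  define A B where "A = p + (1 - p) * c" and "B = p + (1 - p) * c\<^sup>2"
  assume "\<not> p + (1 - p) * c \<le> 0"
  then have A: "0 < A" by (simp add: A_def)
  have B: "0 \<le> B" using p by (simp add: B_def)
  define t where "t = min (t0 / 2) (A * r / (B + 1))"
  have t2: "t \<le> t0 / 2" "t \<le> A * r / (B + 1)"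
    by (simp_all only: t_def min.cobounded1 min.cobounded2)
  have pos: "0 < A * r / (B + 1)" using A B r by (intro divide_pos_pos) auto
  have t: "0 < t" "t < t0" "t * (B + 1) \<le> A * r"
  proof -
    show "0 < t" using t0 pos by (simp add: t_def)
    show "t < t0" using t2(1) t0 by linarith
    show "t * (B + 1) \<le> A * r" using t2(2) B by (simp add: pos_le_divide_eq)
  qed
  have "r\<^sup>2 \<le> p * (r - t)\<^sup>2 + (1 - p) * (r - c * t)\<^sup>2" using le t by blast
  also have "\<dots> = r\<^sup>2 - 2 * r * A * t + B * t * t"
    by (simp add: A_def B_def power2_eq_square algebra_simps)
  finally have "t * (2 * r * A) \<le> t * (t * B)" by (simp add: mult_ac)
  then have "2 * r * A \<le> t * B" using t by simp
  also have "\<dots> \<le> t * (B + 1)" using t by (simp add: distrib_left)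
  also have "\<dots> \<le> A * r" by (rule t)
  finally show False using mult_pos_pos[OF A r] by (simp add: mult_ac)
qed

theorem theorem4p2:
  fixes k :: real and X :: "'a::complete_space set"
  assumes CATk: "CAT k TYPE('a)"
    and cpt: "compact X" and ne: "X \<noteq> {}"
    and ball: "k > 0 \<Longrightarrow> \<exists>c r. r < pi / (2 * sqrt k) \<and> X \<subseteq> ball c r"
    and Y: "\<exists>Y. compact Y \<and> (\<forall>\<mu>\<in>Prob_on X. \<forall>z. barycenter \<mu> z \<longrightarrow> z \<in> Y)"
  shows "(\<exists>!y. circumcenter X y)
    \<and> diam_set X \<ge> S_inf (circumradius X) k
    \<and> (\<forall>n::nat. \<forall>\<mu>. n \<ge> 1 \<and> variance_maximizer X \<mu> \<and>
          (\<exists>F. F \<subseteq> X \<and> finite F \<and> card F = n + 1 \<and> emeasure \<mu> F = 1)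
          \<longrightarrow> diam_set X \<ge> S (circumradius X) n k)"
proof -
  \<comment> \<open>The locale at max k 0 supplies the circumcenter and the variance bound;
    \<open>st\<close> is then rebound to the comparison at k itself, from which the bounds on D
    come.\<close>
  interpret small_compact "max k 0" X
    using CAT_imp_stewart_max[OF CATk] cpt ne ball by unfold_locales (auto simp: max_def split: if_splits)
  note st = CAT_imp_stewart[OF CATk]
  define D where "D = diam_set X"
  have below: "below_Dk k (2 * R)" using below_2R by (auto simp: below_Dk_def max_def split: if_splits)
  obtain y where y: "circumcenter X y" using ex_circumcenter by blast
  have yR: "dist x y \<le> R" if "x \<in> X" for x using y that by (auto simp: circumcenter_def dist_commute)
  have D_upper: "dist x x' \<le> D" if "x \<in> X" "x' \<in> X" for x x'
  proof -
    have "bdd_above ((\<lambda>p. dist (fst p) (snd p)) ` (X \<times> X))"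
      using cpt by (intro bounded_imp_bdd_above compact_imp_bounded compact_continuous_image compact_Times)
        (auto intro!: continuous_intros)
    from cSUP_upper[OF _ this, of "(x, x')"] that show ?thesis by (simp add: D_def diam_set_def)
  qed
  have D2R: "D \<le> 2 * R"
    unfolding D_def diam_set_def
  proof (rule cSUP_least)
    fix p assume "p \<in> X \<times> X"
    then show "dist (fst p) (snd p) \<le> 2 * R"
      using yR[of "fst p"] yR[of "snd p"] dist_triangle2[of "fst p" "snd p" y] by auto
  qed (use ne in auto)
  obtain x1 where x1: "x1 \<in> X" "R \<le> dist x1 y" using ex_dist_ge_circumradius[OF cpt ne] by blast
  have D0: "0 \<le> D" using D_upper[OF x1(1) x1(1)] by simp
  have x1R: "dist x1 y = R" using x1 yR by force
  note S_le = S_coef_le[OF R_nonneg below D0 D2R]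
  have sR: "0 < sn k R" if "0 < R" using that below_Dk_mono[OF below] by (intro sn_pos) auto
  have inf: "S_inf R k \<le> D"
    unfolding S_inf_def
  proof (rule S_le)
    have "(sn k R)\<^sup>2 \<le> md k D"
    proof (cases "R = 0")
      case False
      then have R: "0 < R" using R_nonneg by simp
      show ?thesis
      proof (rule ccontr)
        assume "\<not> ?thesis"
        then have c: "0 < 1 - md k D / (sn k R)\<^sup>2" using sR[OF R] by simp
        define c where "c = (1 - md k D / (sn k R)\<^sup>2) / 2"
        have c': "0 < c" "c < 1 - md k D / (sn k R)\<^sup>2" using c by (auto simp: c_def)
        from ex_closer_point[OF st R below yR x1R D_upper[OF _ x1(1)] D2R c'(2)]
        obtain t0 where t0: "0 < t0" "\<forall>t. 0 < t \<and> t < t0 \<longrightarrow> (\<exists>z. dist x1 z = R - t \<and> (\<forall>x\<in>X. dist x z \<le> R - c * t))"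
          by blast
        then obtain z where "\<forall>x\<in>X. dist x z \<le> R - c * (t0 / 2)"
          using dense[of 0 t0] by (metis field_less_half_sum half_gt_zero_iff field_sum_of_halves less_add_same_cancel1)
        then have "R \<le> R - c * (t0 / 2)" by (intro circumradius_le_cball[OF cpt ne]) auto
        with c' t0(1) show False by (simp add: mult_le_0_iff)
      qed
    qed simp
    then show "(1 / sqrt 2)\<^sup>2 * (2 * (sn k R)\<^sup>2) \<le> md k D" by (simp add: power_divide)
  qed simp
  have fin: "S R n k \<le> D" if n: "n \<ge> 1" and \<mu>: "variance_maximizer X \<mu>"
    and F: "F \<subseteq> X" "finite F" "card F = n + 1" "emeasure \<mu> F = 1" for n :: nat and \<mu> F
    unfolding S_def
  proof (rule S_le)
    have "(1 + 1 / n) * (sn k R)\<^sup>2 \<le> md k D"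
    proof (cases "R = 0")
      case False
      then have R: "0 < R" using R_nonneg by simp
      have pr: "prob_space \<mu>" and sets: "sets \<mu> = sets borel"
        using \<mu> by (auto simp: variance_maximizer_def Prob_on_def)
      define p where "p = (\<lambda>x. measure \<mu> {x})"
      note int = finite_support_integral[OF pr sets F(2,4), folded p_def]
      have p0: "0 \<le> p x" for x by (simp add: p_def)
      have p1: "(\<Sum>x\<in>F. p x) = 1" using int[of "\<lambda>_. 1"] prob_space.prob_space[OF pr] by (simp add: p_def)
      have low: "R\<^sup>2 \<le> (\<Sum>x\<in>F. p x * (dist x z)\<^sup>2)" for z
        using circumradius_le_maximal_Var[OF R \<mu>] Var_le[of \<mu> z] int[OF borel_measurable_dist_square[of z]]
        by (simp add: p_def)
      have "\<exists>x\<in>F. 1 / (real n + 1) \<le> p x"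
      proof (rule ccontr)
        assume "\<not> ?thesis"
        moreover have "F \<noteq> {}" using F by auto
        ultimately have "(\<Sum>x\<in>F. p x) < (\<Sum>x\<in>F. 1 / (real n + 1))"
          using F by (intro sum_strict_mono) (auto simp: not_le)
        then show False using F by (simp add: p1)
      qed
      then obtain x0 where x0: "x0 \<in> F" "1 / (real n + 1) \<le> p x0" by blast
      then have x0X: "x0 \<in> X" using F by blast
      define q where "q = p x0"
      have rest: "(\<Sum>x\<in>F - {x0}. p x) = 1 - q" using p1 F x0 by (simp add: q_def sum_diff1)
      have "0 \<le> 1 - q" unfolding rest[symmetric] using p0 by (intro sum_nonneg) auto
      then have q: "0 < q" "q \<le> 1" using x0 by (auto simp: q_def intro: less_le_trans[of _ "1 / (real n + 1)"])
      have low2: "R\<^sup>2 \<le> q * (dist x0 z)\<^sup>2 + (1 - q) * b\<^sup>2" if "\<And>x. x \<in> X \<Longrightarrow> dist x z \<le> b" for z b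
      proof -
        have "(\<Sum>x\<in>F - {x0}. p x * (dist x z)\<^sup>2) \<le> (\<Sum>x\<in>F - {x0}. p x * b\<^sup>2)"
          using that F p0 by (intro sum_mono mult_left_mono power_mono) auto
        also have "\<dots> = (1 - q) * b\<^sup>2" by (simp add: rest flip: sum_distrib_right)
        finally show ?thesis using low[of z] sum.remove[OF F(2) x0(1), of "\<lambda>x. p x * (dist x z)\<^sup>2"] by (simp add: q_def)
      qed
      \<comment> \<open>At z = y the other atoms contribute at most (1 - q) R^2, so x0 must itself
        be at distance R.\<close>
      have "q * R\<^sup>2 \<le> q * (dist x0 y)\<^sup>2" using low2[OF yR] by (simp add: algebra_simps)
      then have "R\<^sup>2 \<le> (dist x0 y)\<^sup>2" using q by simp
      then have "R \<le> dist x0 y" by (rule power2_le_imp_le) simp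
      then have x0R: "dist x0 y = R" using yR[OF x0X] by simp
      show ?thesis
      proof (rule ccontr)
        assume "\<not> ?thesis"
        then have "md k D / (sn k R)\<^sup>2 < 1 + 1 / n" using sR[OF R] by (simp add: pos_divide_less_eq)
        then have "- 1 / n < 1 - md k D / (sn k R)\<^sup>2" by simp
        \<comment> \<open>\<open>c\<close> may be negative: moving towards x0 may take y away from
          other points of X, but at a rate below 1 / n.\<close>
        from dense[OF this] obtain c where c: "- 1 / n < c" "c < 1 - md k D / (sn k R)\<^sup>2" by blast
        from ex_closer_point[OF st R below yR x0R D_upper[OF _ x0X] D2R c(2)]
        obtain t0 where t0: "0 < t0"
          "\<forall>t. 0 < t \<and> t < t0 \<longrightarrow> (\<exists>z. dist x0 z = R - t \<and> (\<forall>x\<in>X. dist x z \<le> R - c * t))"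
          by blast
        have "R\<^sup>2 \<le> q * (R - t)\<^sup>2 + (1 - q) * (R - c * t)\<^sup>2" if t: "0 < t" "t < t0" for t
        proof -
          obtain z where "dist x0 z = R - t" "\<forall>x\<in>X. dist x z \<le> R - c * t"
            using t0(2) t by blast
          with low2[of z "R - c * t"] show ?thesis by simp
        qed
        from weighted_squares_lower_bound[OF R _ q(2) t0(1) this] q
        have "q + (1 - q) * c \<le> 0" by simp
        \<comment> \<open>The mass bound q >= 1 / (n + 1) means (1 - q) / n <= q, so c > -1 / n
          makes the sum positive. For q = 1 the factor 1 - q vanishes and the strict inequality
          comes from q alone.\<close>
        moreover have "0 < q + (1 - q) * c"
        proof (cases "q = 1")
          case False
          then have "(1 - q) * (- 1 / n) < (1 - q) * c" using c q by (intro mult_strict_left_mono) auto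
          moreover have "(1 - q) / n \<le> q" using x0(2) n by (simp add: q_def field_simps)
          ultimately show ?thesis by simp
        qed simp
        ultimately show False by simp
      qed
    qed simp
    moreover have "(sqrt ((real n + 1) / (2 * real n)))\<^sup>2 * (2 * (sn k R)\<^sup>2) = (1 + 1 / n) * (sn k R)\<^sup>2"
      using n by (simp add: field_simps)
    ultimately show "(sqrt ((real n + 1) / (2 * real n)))\<^sup>2 * (2 * (sn k R)\<^sup>2) \<le> md k D" by simp
  qed simp
  show ?thesis
    using y circumcenter_unique inf fin unfolding D_def by blast
qed

end
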